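(* The code $\mathcal C_3(\mathbb D_d)$ has length $3^{2m}$, dimension $\frac{9m^2+7m}{2}+1$ over $\mathbb F_3$, and minimum Hamming distance at least $3^{2m-2}$.
   Context: Let $m\ge 2$ be an integer and $q=3^{2m}$. For $s\in\{m,2m\}$ let $\mathrm{Tr}_s:\mathbb F_{3^s}\to\mathbb F_3$ denote the absolute trace, $\mathrm{Tr}_s(x)=\sum_{i=0}^{s-1}x^{3^i}$. Vectors in $\mathbb F_3^{q}$ are indexed by the elements of $\mathbb F_{3^{2m}}$; a function $f:\mathbb F_{3^{2m}}\to\mathbb F_3$ is identified with the vector $(f(t))_{t\in\mathbb F_{3^{2m}}}$. Let $\mathcal C(2m,3)=\{c(a,b,h): a\in\mathbb F_{3^m}, b\in\mathbb F_{3^{2m}}, h\in\mathbb F_3\}$ where $c(a,b,h)=(\mathrm{Tr}_{2m}(at^{3^m+1}+bt)+h)_{t\in\mathbb F_{3^{2m}}}$. Let $d$ be the minimum Hamming weight of a nonzero codeword of $\mathcal C(2m,3)$ (it equals $2\cdot 3^{2m-1}-3^{m-1}$). Let $\mathbb D_d$ be the incidence structure with point set $\mathbb F_{3^{2m}}$ whose blocks are the supports $\{t: c_t\neq 0\}$ of the codewords $c\in\mathcal C(2m,3)$ of weight $d$. Let $\mathcal C_3(\mathbb D_d)$ be the $\mathbb F_3$-linear span in $\mathbb F_3^{\mathbb F_{3^{2m}}}$ of the incidence vectors of the blocks (the incidence vector of a block $B$ has entry $1$ at $t\in B$ and $0$ elsewhere). *)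

theory Defs
  imports Complex_Main "HOL-Library.Function_Algebras"
begin

text \<open>The field F_{3^{2m}} is modelled by a finite field type 'a with CARD('a) = 3^(2m),
  F_3 by a finite field type 'b with CARD('b) = 3. F_{3^m} is the subfield
  of 'a consisting of the x with x^(3^m) = x.\<close>

definition tr :: "nat \<Rightarrow> 'a::field \<Rightarrow> 'a" where
  "tr s x = (\<Sum>i<s. x ^ (3 ^ i))"

text \<open>Identification of the prime subfield {0,1,2} of 'a with the field 'b of order 3.\<close>
definition to_F3 :: "'a::field \<Rightarrow> 'b::field" where
  "to_F3 x = of_nat (LEAST k. (of_nat k :: 'a) = x)"

definition codeword :: "nat \<Rightarrow> 'a::field \<Rightarrow> 'a \<Rightarrow> 'b::field \<Rightarrow> ('a \<Rightarrow> 'b)" where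
  "codeword m a b h = (\<lambda>t. to_F3 (tr (2*m) (a * t ^ (3^m + 1) + b * t)) + h)"

definition code :: "nat \<Rightarrow> ('a::field \<Rightarrow> 'b::field) set" where
  "code m = {codeword m a b h | a b h. a ^ (3^m) = a}"

definition wt :: "('a \<Rightarrow> 'b::zero) \<Rightarrow> nat" where
  "wt c = card {t. c t \<noteq> 0}"

definition min_wt :: "nat \<Rightarrow> ('a::field \<Rightarrow> 'b::field) itself \<Rightarrow> nat" where
  "min_wt m _ = Min {wt c | c :: 'a \<Rightarrow> 'b. c \<in> code m \<and> c \<noteq> 0}"

definition blocks :: "nat \<Rightarrow> ('a::field \<Rightarrow> 'b::field) itself \<Rightarrow> 'a set set" where
  "blocks m T = {{t. c t \<noteq> 0} | c :: 'a \<Rightarrow> 'b. c \<in> code m \<and> wt c = min_wt m T}"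

definition incvec :: "'a set \<Rightarrow> ('a \<Rightarrow> 'b::field)" where
  "incvec B = (\<lambda>t. if t \<in> B then 1 else 0)"

definition fscale :: "'b::field \<Rightarrow> ('a \<Rightarrow> 'b) \<Rightarrow> ('a \<Rightarrow> 'b)" where
  "fscale c v = (\<lambda>t. c * v t)"

definition design_code :: "nat \<Rightarrow> ('a::field \<Rightarrow> 'b::field) set" where
  "design_code m = module.span fscale (incvec ` blocks m TYPE('a \<Rightarrow> 'b))"

end

(* Completing the square shows that the supports of the minimum weight words are exactly the sets
where Tr(a N(t - u)) + e is nonzero; here N(t) = t^(3^m + 1) is the norm to the subfield F of order
3^m, a in F is nonzero and e = 1 or -1. Seen inside the large field, their incidence vectors are the
squares (Tr(a N(t - u)) + e)^2, and lifting to functions with values in the large field preserves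
dimensions. Taking combinations over e and u and polarizing, one finds in the span of these squares
all products of at most two of the functions Tr(c N(t)), Tr(b t). As a function of b, Tr(b y) is a
polynomial with coefficients y^(3^i), so every coefficient lies in the span too. Hence the span is
generated by the monomials t^e with e of the form 0, 3^k, 3^k + 3^l, (3^m + 1) 3^i + 3^k or
(3^m + 1)(3^i + 3^j). Uniqueness of ternary digits makes these exponents easy to count, and they are
at most 8 * 3^(2m-2), so a nonzero element has at most that many zeros among the 9 * 3^(2m-2) points. *)

theory Submission
  imports Defs "HOL-Computational_Algebra.Polynomial" "HOL-Computational_Algebra.Primes" "HOL-Library.Cardinality"
begin

section \<open>Finite fields: characteristic, root bounds and power sums\<close>

lemma power_CARD_minus_1:
  fixes x :: "'a::{field,finite}"
  assumes "x \<noteq> 0"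
  shows "x ^ (CARD('a) - 1) = 1"
proof -
  have "(\<Prod>y\<in>UNIV-{0}. x * y) = (\<Prod>y\<in>UNIV-{0}. y)"
    by (rule prod.reindex_bij_witness[of _ "\<lambda>y. y / x" "\<lambda>y. x * y"]) (use assms in auto)
  then have "x ^ (CARD('a) - 1) * \<Prod>(UNIV-{0}) = 1 * \<Prod>(UNIV-{0::'a})"
    by (simp add: prod.distrib)
  then show ?thesis
    by (subst (asm) mult_right_cancel) auto
qed

lemma finite_field_power_CARD:
  fixes x :: "'a::{field,finite}"
  shows "x ^ CARD('a) = x"
proof (cases "x = 0")
  case False
  then show ?thesis
    using power_minus_mult[of "CARD('a)" x] power_CARD_minus_1[of x] by simp
qed (simp add: power_0_left)

text \<open>Translation by 1 permutes the ring, so the sum of all elements equals itself plus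
  \<open>of_nat CARD('a)\<close>.\<close>

lemma of_nat_CARD_eq_0: "of_nat CARD('a) = (0 :: 'a::{ring_1,finite})"
proof -
  have "(\<Sum>x\<in>UNIV. x) = (\<Sum>x\<in>UNIV. x + 1 :: 'a)"
    by (rule sum.reindex_bij_witness[of _ "\<lambda>x. x + 1" "\<lambda>x. x - 1"]) auto
  then show ?thesis
    by (simp add: sum.distrib)
qed

lemma finite_field_CHAR:
  assumes "prime p" and "CARD('a::{field,finite}) = p ^ n"
  shows "CHAR('a) = p"
proof -
  have "CHAR('a) dvd p ^ n"
    using assms(2) of_nat_CARD_eq_0[where 'a = 'a] by (metis of_nat_eq_0_iff_char_dvd)
  moreover have "prime CHAR('a)"
    by (simp add: prime_CHAR_semidom finite_imp_CHAR_pos)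
  ultimately show ?thesis
    using assms(1) by (metis primes_dvd_imp_eq prime_dvd_power)
qed

lemma card_power_eq_self_le:
  fixes n :: nat
  assumes "n \<ge> 2"
  shows "card {x :: 'a::field. x ^ n = x} \<le> n"
proof -
  let ?p = "monom 1 n - monom 1 1 :: 'a poly"
  have "coeff ?p n \<noteq> 0"
    using assms by simp
  then have "?p \<noteq> 0"
    by (metis coeff_0)
  moreover have "degree ?p \<le> n"
    by (rule degree_diff_le) (use assms in \<open>auto simp: degree_monom_eq\<close>)
  ultimately show ?thesis
    using card_poly_roots_bound[of ?p] by (auto simp: poly_monom)
qed

lemma card_power_eq_const_le:
  fixes n :: nat
  assumes "n > 0"
  shows "card {x :: 'a::field. x ^ n = c} \<le> n"
proof -
  let ?p = "monom 1 n - [:c:] :: 'a poly"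
  have "coeff ?p n \<noteq> 0"
    using assms by (simp add: coeff_pCons split: nat.split)
  then have "?p \<noteq> 0"
    by (metis coeff_0)
  moreover have "degree ?p \<le> n"
    by (rule degree_diff_le) (use assms in \<open>auto simp: degree_monom_eq\<close>)
  ultimately show ?thesis
    using card_poly_roots_bound[of ?p] by (auto simp: poly_monom)
qed

text \<open>With \<open>Suc n\<close> terms the trace is a polynomial in \<open>x\<close> of degree
  \<open>3 ^ n\<close>, and its leading coefficient \<open>a ^ 3 ^ n\<close> does not
  vanish.\<close>

lemma card_tr_eq_const_le:
  assumes "a \<noteq> 0"
  shows "card {x :: 'a::field. tr (Suc n) (a * x) = c} \<le> 3 ^ n"
proof -
  let ?p = "(\<Sum>i<Suc n. monom (a ^ 3 ^ i) (3 ^ i)) - [:c:]"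
  have "coeff ?p (3 ^ n) = (\<Sum>i<Suc n. if i = n then a ^ 3 ^ n else 0)"
    by (auto simp: coeff_sum coeff_pCons intro!: sum.cong split: nat.split)
  then have "coeff ?p (3 ^ n) \<noteq> 0"
    using assms by simp
  then have "?p \<noteq> 0"
    by (metis coeff_0)
  moreover have "degree ?p \<le> 3 ^ n"
    by (intro degree_diff_le degree_sum_le)
      (auto intro!: order.trans[OF degree_monom_le] power_increasing)
  moreover have "poly ?p x = 0 \<longleftrightarrow> tr (Suc n) (a * x) = c" for x
    by (simp add: tr_def poly_sum poly_monom power_mult_distrib)
  ultimately show ?thesis
    using card_poly_roots_bound[of ?p] by simp
qed

lemma card_eq_sum_fibres:
  assumes "finite A" "finite B" "f ` A \<subseteq> B"
  shows "card A = (\<Sum>y\<in>B. card {x \<in> A. f x = y})"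
  using sum.group[of A B f "\<lambda>_. 1 :: nat"] assms by simp

text \<open>Turns root bounds into exact counts: if no fibre exceeds \<open>k\<close> and the total
  leaves no slack, a smaller fibre could not be compensated by the others.\<close>

lemma card_fibre_eq:
  assumes "finite A" and "finite B" and "f ` A \<subseteq> B"
    and le: "\<And>y. y \<in> B \<Longrightarrow> card {x \<in> A. f x = y} \<le> k"
    and "k * card B \<le> card A" and "y \<in> B"
  shows "card {x \<in> A. f x = y} = k"
proof (rule ccontr)
  assume "card {x \<in> A. f x = y} \<noteq> k"
  then have "card {x \<in> A. f x = y} < k"
    using le[OF \<open>y \<in> B\<close>] by simp
  then have "(\<Sum>y\<in>B. card {x \<in> A. f x = y}) < (\<Sum>y\<in>B. k)"
    using assms by (intro sum_strict_mono_ex1) auto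
  moreover have "(\<Sum>y\<in>B. card {x \<in> A. f x = y}) = card A"
    using card_eq_sum_fibres[of A B f] assms by simp
  ultimately show False
    using assms by (simp add: mult.commute)
qed

text \<open>Some nonzero \<open>g\<close> has \<open>g ^ k\<close> different from 1, since with r =
  k mod (q - 1) the equation X^r = 1 has at most r < q - 1 roots. Substituting \<open>g * x\<close>
  for \<open>x\<close> multiplies the sum by \<open>g ^ k\<close>, so it vanishes.\<close>

lemma power_sum_eq_0:
  fixes k :: nat
  assumes "k > 0" and "\<not> CARD('a) - 1 dvd k"
  shows "(\<Sum>x\<in>UNIV. x ^ k :: 'a::{field,finite}) = 0"
proof -
  let ?r = "k mod (CARD('a) - 1)"
  have r: "?r > 0" "?r < CARD('a) - 1"
  proof -
    show "?r > 0"
      using assms(2) by (simp add: dvd_eq_mod_eq_0)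
    have "2 \<le> CARD('a)"
      using card_mono[of UNIV "{0, 1 :: 'a}"] by simp
    then show "?r < CARD('a) - 1"
      by simp
  qed
  have "card (UNIV - {0 :: 'a}) > card {x :: 'a. x ^ ?r = 1}"
    using card_power_eq_const_le[of ?r "1 :: 'a"] r by simp
  then have "\<not> UNIV - {0 :: 'a} \<subseteq> {x :: 'a. x ^ ?r = 1}"
    by (meson card_mono finite leD)
  then obtain g :: 'a where g: "g \<noteq> 0" "g ^ ?r \<noteq> 1"
    by auto
  have "g ^ (CARD('a) - 1) = 1"
    using g by (intro power_CARD_minus_1)
  then have "g ^ k = g ^ ?r"
    using power_add[of g "(CARD('a) - 1) * (k div (CARD('a) - 1))" ?r] by (simp add: power_mult)
  have "(\<Sum>x\<in>UNIV. x ^ k :: 'a) = (\<Sum>x\<in>UNIV. (g * x) ^ k)"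
    by (rule sum.reindex_bij_witness[of _ "\<lambda>x. g * x" "\<lambda>x. x / g"]) (use g in auto)
  also have "\<dots> = g ^ k * (\<Sum>x\<in>UNIV. x ^ k)"
    by (simp add: power_mult_distrib sum_distrib_left)
  finally have "(1 - g ^ k) * (\<Sum>x\<in>UNIV. x ^ k) = 0"
    by (simp add: algebra_simps)
  then show ?thesis
    using g \<open>g ^ k = g ^ ?r\<close> by simp
qed

section \<open>Function spaces and extraction of coefficients\<close>

interpretation fs: vector_space "fscale :: 'b::field \<Rightarrow> ('a \<Rightarrow> 'b) \<Rightarrow> ('a \<Rightarrow> 'b)"
  by standard (auto simp: fscale_def fun_eq_iff algebra_simps)

lemma fscale_apply [simp]: "fscale c v t = c * v t"
  by (simp add: fscale_def)

lemma sum_fun_apply: "(\<Sum>i\<in>I. f i) t = (\<Sum>i\<in>I. f i t)"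
  by (induction I rule: infinite_finite_induct) auto

text \<open>Multiplying by a suitable power of \<open>b\<close> and summing over \<open>b\<close> isolates one coefficient.\<close>

lemma subspace_coefficient:
  fixes v :: "'i \<Rightarrow> 'c \<Rightarrow> 'a::{field,finite}"
  assumes S: "fs.subspace S" and "finite I" "inj_on e I"
    and e: "\<And>i. i \<in> I \<Longrightarrow> 0 < e i \<and> e i < CARD('a) - 1"
    and sums: "\<And>b. (\<lambda>t. \<Sum>i\<in>I. b ^ e i * v i t) \<in> S"
    and i: "i \<in> I"
  shows "v i \<in> S"
proof -
  let ?q = "CARD('a) - 1"
  \<comment> \<open>Orthogonality of powers: the diagonal sum counts the nonzero \<open>b\<close>,
    which gives -1 in the field, and every other sum is a vanishing power sum.\<close>
  have power_sum: "(\<Sum>b\<in>UNIV. b ^ (?q - e i) * b ^ e j) = (if i = j then -1 else 0 :: 'a)"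
    if "j \<in> I" for j
  proof (cases "i = j")
    case True
    have "b ^ (?q - e i) * b ^ e i = (if b = 0 then 0 else 1)" for b :: 'a
    proof -
      have "b ^ (?q - e i) * b ^ e i = b ^ ?q"
        using e[OF i] le_add_diff_inverse2[of "e i" ?q] by (metis less_imp_le power_add)
      then show ?thesis
        using e[OF i] power_CARD_minus_1[of b] by (auto simp: power_0_left)
    qed
    then have "(\<Sum>b\<in>UNIV. b ^ (?q - e i) * b ^ e i :: 'a) = (\<Sum>b\<in>UNIV. 1 - (if b = (0 :: 'a) then 1 else 0))"
      by (intro sum.cong) auto
    also have "\<dots> = of_nat CARD('a) - 1"
      by (subst sum_subtractf) (simp add: sum.delta)
    finally show ?thesis
      using True by (simp add: of_nat_CARD_eq_0)
  next
    case False
    let ?k = "?q - e i + e j"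
    have ne: "e i \<noteq> e j"
      using False \<open>inj_on e I\<close> i that by (meson inj_onD)
    have "\<not> ?q dvd ?k"
    proof
      \<comment> \<open>The exponent lies strictly between 0 and \<open>2 * ?q\<close>, so
        divisibility would make it equal to \<open>?q\<close> and force
        \<open>e i = e j\<close>.\<close>
      assume "?q dvd ?k"
      then obtain l where l: "?k = ?q * l"
        by auto
      have "?q * l < ?q * 2" "0 < ?q * l"
        using e[OF i] e[OF that] l by linarith+
      then have "l = 1"
        by simp
      then show False
        using l ne e[OF i] by (metis add_left_cancel le_add_diff_inverse2 less_imp_le mult.right_neutral)
    qed
    then have "(\<Sum>b\<in>UNIV. b ^ ?k :: 'a) = 0"
      by (rule power_sum_eq_0[rotated]) (use e[OF i] in linarith)
    then show ?thesis
      using False by (simp add: power_add)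
  qed
  have "(\<Sum>b\<in>UNIV. fscale (- (b ^ (?q - e i))) (\<lambda>t. \<Sum>j\<in>I. b ^ e j * v j t)) \<in> S"
    by (intro fs.subspace_sum[OF S] fs.subspace_scale[OF S] sums)
  also have "(\<Sum>b\<in>UNIV. fscale (- (b ^ (?q - e i))) (\<lambda>t. \<Sum>j\<in>I. b ^ e j * v j t)) = v i"
  proof
    fix t
    have "(\<Sum>b\<in>UNIV. fscale (- (b ^ (?q - e i))) (\<lambda>t. \<Sum>j\<in>I. b ^ e j * v j t)) t
      = (\<Sum>b\<in>UNIV. \<Sum>j\<in>I. - (b ^ (?q - e i) * b ^ e j) * v j t)"
      by (simp add: sum_fun_apply sum_distrib_left sum_negf mult.assoc)
    also have "\<dots> = (\<Sum>j\<in>I. - (\<Sum>b\<in>UNIV. b ^ (?q - e i) * b ^ e j) * v j t)"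
      by (subst sum.swap) (simp add: sum_distrib_right sum_negf)
    also have "\<dots> = (\<Sum>j\<in>I. if i = j then v j t else 0)"
      by (intro sum.cong refl) (simp only: power_sum, simp)
    finally show "(\<Sum>b\<in>UNIV. fscale (- (b ^ (?q - e i))) (\<lambda>t. \<Sum>j\<in>I. b ^ e j * v j t)) t = v i t"
      using \<open>finite I\<close> i by simp
  qed
  finally show ?thesis .
qed

section \<open>Trace functions in characteristic three\<close>

locale ternary_trace =
  fixes s :: nat and TA :: "'a::{field,finite} itself"
  assumes s: "s > 0" and card: "CARD('a) = 3 ^ s"
begin

lemma CHAR: "CHAR('a) = 3"
  using finite_field_CHAR[of 3] card by simp

lemma power_3_add: "(x + y) ^ (3 ^ i) = x ^ (3 ^ i) + (y :: 'a) ^ (3 ^ i)"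
  by (rule freshmans_dream') (simp_all add: CHAR)

lemma power_3_sum: "sum f A ^ (3 ^ i) = (\<Sum>x\<in>A. f x ^ (3 ^ i) :: 'a)"
  by (rule freshmans_dream_sum') (simp_all add: CHAR)

lemma power_3_diff: "(x - y) ^ (3 ^ i) = x ^ (3 ^ i) - (y :: 'a) ^ (3 ^ i)"
  using power_3_add[of "x - y" y i] by simp

lemma three_eq_0: "(3 :: 'a) = 0"
  using of_nat_CHAR[where 'a = 'a] by (simp add: CHAR)

lemma two_eq_m1: "(2 :: 'a) = -1"
  using three_eq_0 by (simp add: eq_neg_iff_add_eq_0)

lemma power_card_s: "(x :: 'a) ^ (3 ^ s) = x"
  using finite_field_power_CARD[of x] by (simp add: card)

lemma tr_add: "tr n (x + y) = tr n x + tr n (y :: 'a)"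
  by (simp add: tr_def power_3_add sum.distrib)

lemma tr_0 [simp]: "tr n 0 = (0 :: 'a)"
  by (simp add: tr_def power_0_left)

lemma tr_minus: "tr n (- x) = - tr n (x :: 'a)"
  using tr_add[of n x "- x"] by (simp add: eq_neg_iff_add_eq_0 add.commute)

lemma tr_diff: "tr n (x - y) = tr n x - tr n (y :: 'a)"
  using tr_add[of n x "- y"] by (simp add: tr_minus)

lemma tr_scale:
  assumes "c ^ 3 = (c :: 'a)"
  shows "tr n (c * x) = c * tr n x"
proof -
  have "c ^ (3 ^ i) = c" for i
    by (induction i) (simp_all add: power_mult assms)
  then show ?thesis
    by (simp add: tr_def power_mult_distrib sum_distrib_left)
qed

text \<open>Cubing shifts the terms cyclically. Adding \<open>x\<close> to both sides turns them
  into the same sum over \<open>Suc s\<close> indices, split off at its two ends.\<close>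

lemma tr_power_3: "tr s (x ^ 3) = tr s (x :: 'a)"
proof -
  have "tr s (x ^ 3) + x = (\<Sum>i<Suc s. x ^ 3 ^ i)"
    by (simp only: sum.lessThan_Suc_shift) (simp add: tr_def flip: power_mult)
  also have "\<dots> = tr s x + x"
    by (simp add: tr_def power_card_s)
  finally show ?thesis
    by simp
qed

lemma tr_power_3_power: "tr s (x ^ (3 ^ i)) = tr s (x :: 'a)"
proof (induction i)
  case (Suc i)
  have "x ^ 3 ^ Suc i = (x ^ 3 ^ i) ^ 3"
    by (simp add: mult.commute flip: power_mult)
  then show ?case
    using Suc tr_power_3 by simp
qed simp

lemma tr_cube: "tr s x ^ 3 = tr s (x :: 'a)"
proof -
  have "tr s x ^ 3 = tr s (x ^ 3)"
    using power_3_sum[of "\<lambda>i. x ^ 3 ^ i" "{..<s}" 1] by (simp add: tr_def power_mult[symmetric] mult.commute)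
  then show ?thesis
    by (simp add: tr_power_3)
qed

lemma exponent_bounds:
  assumes "i < s"
  shows "(0 :: nat) < 3 ^ i \<and> (3 :: nat) ^ i < CARD('a) - 1"
proof -
  have "(3 :: nat) ^ i \<le> 3 ^ (s - 1)" "(1 :: nat) \<le> 3 ^ (s - 1)"
    using assms by (auto intro: power_increasing)
  moreover have "(3 :: nat) ^ s = 3 * 3 ^ (s - 1)"
    using s by (cases s) auto
  moreover have "(0 :: nat) < 3 ^ i"
    by simp
  ultimately show ?thesis
    unfolding card by linarith
qed

lemma inj_on_power_3: "inj_on (\<lambda>i. 3 ^ i :: nat) A"
  by (auto intro: inj_onI)

text \<open>Read as a polynomial in \<open>b\<close>, the trace has the distinct exponents
  \<open>3 ^ i\<close>. The cofactor \<open>z\<close> allows a second extraction from a product of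
  two traces.\<close>

lemma tr_coefficient:
  fixes y z :: "'c \<Rightarrow> 'a"
  assumes S: "fs.subspace S"
    and "\<And>b. (\<lambda>t. tr s (b * y t) * z t) \<in> S"
    and "i < s"
  shows "(\<lambda>t. y t ^ (3 ^ i) * z t) \<in> S"
proof (rule subspace_coefficient[OF S, where I = "{..<s}" and e = "\<lambda>i. 3 ^ i"
      and v = "\<lambda>i t. y t ^ (3 ^ i) * z t"])
  show "(\<lambda>t. \<Sum>i<s. b ^ 3 ^ i * (y t ^ 3 ^ i * z t)) \<in> S" for b
    using assms(2)[of b] by (simp add: tr_def power_mult_distrib sum_distrib_right mult.assoc)
qed (use assms exponent_bounds inj_on_power_3 in auto)

lemma tr_coefficient2:
  fixes y z :: "'c \<Rightarrow> 'a"
  assumes S: "fs.subspace S"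
    and *: "\<And>b c. (\<lambda>t. tr s (b * y t) * tr s (c * z t)) \<in> S"
    and "i < s" "j < s"
  shows "(\<lambda>t. y t ^ (3 ^ i) * z t ^ (3 ^ j)) \<in> S"
proof -
  have "(\<lambda>t. tr s (c * z t) * y t ^ (3 ^ i)) \<in> S" for c
    using tr_coefficient[OF S *  \<open>i < s\<close>] by (simp add: mult.commute)
  from tr_coefficient[OF S this \<open>j < s\<close>] show ?thesis
    by (simp add: mult.commute)
qed

lemma tr_product_in:
  fixes y z :: "'c \<Rightarrow> 'a"
  assumes S: "fs.subspace S"
    and "\<And>i j. i < s \<Longrightarrow> j < s \<Longrightarrow> (\<lambda>t. y t ^ (3 ^ i) * z t ^ (3 ^ j)) \<in> S"
  shows "(\<lambda>t. tr s (b * y t) * tr s (c * z t)) \<in> S"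
proof -
  have "(\<Sum>i<s. \<Sum>j<s. fscale (b ^ 3 ^ i * c ^ 3 ^ j) (\<lambda>t. y t ^ (3 ^ i) * z t ^ (3 ^ j))) \<in> S"
    by (intro fs.subspace_sum[OF S] fs.subspace_scale[OF S] assms) auto
  also have "(\<Sum>i<s. \<Sum>j<s. fscale (b ^ 3 ^ i * c ^ 3 ^ j) (\<lambda>t. y t ^ (3 ^ i) * z t ^ (3 ^ j)))
      = (\<lambda>t. tr s (b * y t) * tr s (c * z t))"
    by (simp add: fun_eq_iff sum_fun_apply tr_def sum_product power_mult_distrib mult_ac)
  finally show ?thesis .
qed

lemma tr_in:
  fixes y :: "'c \<Rightarrow> 'a"
  assumes S: "fs.subspace S"
    and "\<And>i. i < s \<Longrightarrow> (\<lambda>t. y t ^ (3 ^ i)) \<in> S"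
  shows "(\<lambda>t. tr s (b * y t)) \<in> S"
proof -
  have "(\<Sum>i<s. fscale (b ^ 3 ^ i) (\<lambda>t. y t ^ (3 ^ i))) \<in> S"
    by (intro fs.subspace_sum[OF S] fs.subspace_scale[OF S] assms) auto
  also have "(\<Sum>i<s. fscale (b ^ 3 ^ i) (\<lambda>t. y t ^ (3 ^ i))) = (\<lambda>t. tr s (b * y t))"
    by (simp add: fun_eq_iff sum_fun_apply tr_def power_mult_distrib)
  finally show ?thesis .
qed

lemma tr_square_polarize:
  fixes y :: "'c \<Rightarrow> 'a"
  assumes S: "fs.subspace S"
    and sq: "\<And>b. (\<lambda>t. tr s (b * y t) ^ 2) \<in> S"
  shows "(\<lambda>t. tr s (b * y t) * tr s (c * y t)) \<in> S"
proof -
  have "fscale (-1) ((\<lambda>t. tr s ((b + c) * y t) ^ 2) - (\<lambda>t. tr s (b * y t) ^ 2) - (\<lambda>t. tr s (c * y t) ^ 2)) \<in> S"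
    by (intro fs.subspace_scale[OF S] fs.subspace_diff[OF S] sq)
  also have "fscale (-1) ((\<lambda>t. tr s ((b + c) * y t) ^ 2) - (\<lambda>t. tr s (b * y t) ^ 2) - (\<lambda>t. tr s (c * y t) ^ 2))
     = (\<lambda>t. (3 - 2) * tr s (b * y t) * tr s (c * y t))"
    by (simp only: three_eq_0) (simp add: fun_eq_iff ring_distribs tr_add power2_sum two_eq_m1)
  finally show ?thesis
    by simp
qed

text \<open>The element \<open>x\<close> is the coefficient of the first power of \<open>y\<close>
  in the trace, so extraction from the zero subspace of functions on a one-point set gives the
  claim.\<close>

lemma tr_nondegenerate:
  assumes "\<And>y. tr s (y * x) = (0 :: 'a)"
  shows "x = 0"
proof -
  have "(\<lambda>t::unit. x ^ (3 ^ 0) * 1) \<in> {0}"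
    by (rule tr_coefficient[of "{0}"]) (use assms s in \<open>auto simp: fun_eq_iff\<close>)
  then show ?thesis
    by (simp add: fun_eq_iff)
qed

lemma prime_field_cases:
  assumes "x ^ 3 = (x :: 'a)"
  shows "x = 0 \<or> x = 1 \<or> x = -1"
proof -
  have "x * (x - 1) * (x + 1) = 0"
    using assms by (simp add: algebra_simps power3_eq_cube)
  then show ?thesis
    by (auto simp: eq_neg_iff_add_eq_0)
qed

lemma one_neq_m1: "(1 :: 'a) \<noteq> -1"
proof
  assume "(1 :: 'a) = -1"
  then have "(2 :: 'a) = 0"
    by (simp add: eq_neg_iff_add_eq_0)
  then have "(3 - 2 :: 'a) = 0"
    using three_eq_0 by (simp only: diff_self)
  then show False
    by simp
qed

lemma card_prime_field: "card {x :: 'a. x ^ 3 = x} = 3"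
proof -
  have "{x :: 'a. x ^ 3 = x} = {0, 1, -1}"
    using prime_field_cases by auto
  then show ?thesis
    using one_neq_m1 by auto
qed

end

section \<open>The field of order three inside the large field\<close>

lemma of_nat_eq_iff_mod_CHAR:
  "of_nat l = (of_nat k :: 'a::ring_1) \<longleftrightarrow> l mod CHAR('a) = k mod CHAR('a)"
proof (cases l k rule: linorder_cases)
  case less
  then show ?thesis
    using of_nat_eq_iff_char_dvd[OF less, where 'a = 'a] mod_eq_dvd_iff_nat[of l k "CHAR('a)"] by auto
next
  case greater
  then show ?thesis
    using of_nat_eq_iff_char_dvd[OF greater, where 'a = 'a] mod_eq_dvd_iff_nat[of k l "CHAR('a)"]
    by (auto simp: eq_commute)
qed simp

text \<open>The least representative chosen by \<open>to_F3\<close> agrees with \<open>k\<close>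
  modulo the common characteristic, hence has the same image in the target.\<close>

lemma to_F3_of_nat:
  assumes "CHAR('a::field) = CHAR('b::field)"
  shows "to_F3 (of_nat k :: 'a) = (of_nat k :: 'b)"
proof -
  have "of_nat (LEAST l. (of_nat l :: 'a) = of_nat k) = (of_nat k :: 'a)"
    by (rule LeastI) simp
  then show ?thesis
    using assms unfolding to_F3_def of_nat_eq_iff_mod_CHAR by simp
qed

text \<open>The field of order 3 is the degree 1 instance of the same locale, so its arithmetic is
  available under the prefix \<open>B\<close>.\<close>

locale ternary_pair = ternary_trace "2 * m" TA + B: ternary_trace 1 TB
  for m :: nat and TA :: "'a::{field,finite} itself" and TB :: "'b::{field,finite} itself" +
  assumes m: "m \<ge> 2"
begin

text \<open>The constant \<open>to_F3\<close> is polymorphic in both fields; used in the opposite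
  direction it embeds the field of order 3 into the large one.\<close>

abbreviation lift :: "'b \<Rightarrow> 'a" where
  "lift \<equiv> to_F3"

abbreviation Tr :: "'a \<Rightarrow> 'a" where
  "Tr \<equiv> tr (2 * m)"

lemma CHAR_eq: "CHAR('a) = CHAR('b)"
  by (simp add: CHAR B.CHAR)

lemma cube_B: "y ^ 3 = (y :: 'b)"
  using B.power_card_s[of y] by simp

lemma obtain_of_nat_A:
  assumes "x ^ 3 = (x :: 'a)"
  obtains k where "x = of_nat k"
proof -
  have "x = of_nat 0 \<or> x = of_nat 1 \<or> x = of_nat 2"
    using prime_field_cases[OF assms] unfolding of_nat_numeral two_eq_m1 by simp
  then show thesis
    using that by blast
qed

lemma obtain_of_nat_B:
  obtains k where "(x :: 'b) = of_nat k"
proof -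
  have "x = of_nat 0 \<or> x = of_nat 1 \<or> x = of_nat 2"
    using B.prime_field_cases[OF cube_B] unfolding of_nat_numeral B.two_eq_m1 by simp
  then show thesis
    using that by blast
qed

lemma lift_of_nat [simp]: "lift (of_nat k) = of_nat k"
  by (rule to_F3_of_nat) (simp add: CHAR_eq)

lemma lift_to_F3: "x ^ 3 = x \<Longrightarrow> lift (to_F3 x) = x"
  by (erule obtain_of_nat_A) (simp add: to_F3_of_nat CHAR_eq)

lemma to_F3_lift [simp]: "to_F3 (lift y) = y"
  by (rule obtain_of_nat_B[of y]) (simp add: to_F3_of_nat CHAR_eq)

lemma lift_add: "lift (x + y) = lift x + lift y"
  by (rule obtain_of_nat_B[of x], rule obtain_of_nat_B[of y]) (simp flip: of_nat_add)

lemma lift_mult: "lift (x * y) = lift x * lift y"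
  by (rule obtain_of_nat_B[of x], rule obtain_of_nat_B[of y]) (simp flip: of_nat_mult)

lemma lift_0 [simp]: "lift 0 = 0"
  using lift_of_nat[of 0] by simp

lemma lift_1 [simp]: "lift 1 = 1"
  using lift_of_nat[of 1] by simp

lemma lift_eq_iff [simp]: "lift x = lift y \<longleftrightarrow> x = y"
  by (metis to_F3_lift)

lemma lift_eq_0_iff [simp]: "lift x = 0 \<longleftrightarrow> x = 0"
  using lift_eq_iff[of x 0] by simp

lemma lift_cube: "lift x ^ 3 = lift x"
proof -
  have "lift (x ^ 3) = lift x ^ 3"
    by (simp add: power3_eq_cube lift_mult)
  then show ?thesis
    by (simp add: cube_B)
qed

lemma lift_sum: "lift (sum f A) = (\<Sum>x\<in>A. lift (f x))"
  by (induction A rule: infinite_finite_induct) (simp_all add: lift_add)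

section \<open>Norm and trace over the subfield of order 3^m\<close>

lemma power_Q_Q: "(x ^ 3 ^ m) ^ 3 ^ m = (x :: 'a)"
  using power_card_s[of x] by (simp add: power_add mult_2 flip: power_mult)

lemma norm_power_Q: "(x ^ (3 ^ m + 1)) ^ 3 ^ m = (x :: 'a) ^ (3 ^ m + 1)"
  by (simp add: power_mult_distrib power_Q_Q mult.commute)

lemma Tr_power_Q: "Tr (x ^ 3 ^ m) = Tr x"
  by (rule tr_power_3_power)

text \<open>The two cross terms are conjugate under raising to the power \<open>3 ^ m\<close>, so
  their traces agree. Together they carry the factor -2, which is 1 in characteristic 3.\<close>

lemma complete_square:
  assumes "a ^ 3 ^ m = a"
  shows "Tr (a * (t - u) ^ (3 ^ m + 1))
    = Tr (a * t ^ (3 ^ m + 1) + a * u ^ 3 ^ m * t) + Tr (a * u ^ (3 ^ m + 1))"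
proof -
  have "(a * u * t ^ 3 ^ m) ^ 3 ^ m = a * u ^ 3 ^ m * t"
    using assms by (simp add: power_mult_distrib power_Q_Q)
  then have swap: "Tr (a * u * t ^ 3 ^ m) = Tr (a * u ^ 3 ^ m * t)"
    by (metis Tr_power_Q)
  have "a * (t - u) ^ (3 ^ m + 1)
      = a * t ^ (3 ^ m + 1) - a * u * t ^ 3 ^ m - a * u ^ 3 ^ m * t + a * u ^ (3 ^ m + 1)"
    by (simp add: power_3_diff algebra_simps)
  then have "Tr (a * (t - u) ^ (3 ^ m + 1))
      = Tr (a * t ^ (3 ^ m + 1)) + (- 2) * Tr (a * u ^ 3 ^ m * t) + Tr (a * u ^ (3 ^ m + 1))"
    by (simp add: tr_add tr_diff swap)
  then show ?thesis
    by (simp only: two_eq_m1) (simp add: tr_add)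
qed

definition subfield :: "'a set" where
  "subfield = {x. x ^ 3 ^ m = x}"

lemma Q_bounds: "(9 :: nat) \<le> 3 ^ m" "CARD('a) = 3 ^ m * 3 ^ m"
  using power_increasing[OF m, of "3 :: nat"] by (simp_all add: card mult_2 power_add)

lemma card_subfield_star_le: "card (subfield - {0}) \<le> 3 ^ m - 1"
proof -
  have "card subfield \<le> 3 ^ m"
    unfolding subfield_def by (rule card_power_eq_self_le) (use Q_bounds in simp)
  moreover have "0 \<in> subfield"
    by (simp add: subfield_def)
  ultimately show ?thesis
    by (simp add: card_Diff_singleton)
qed

text \<open>With Q = 3^m, the Q^2 - 1 nonzero elements map to at most Q - 1 nonzero values, and no
  fibre exceeds Q + 1 elements. Hence every fibre attains the bound.\<close>

lemma card_norm_fibre: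
  assumes "y \<in> subfield - {0}"
  shows "card {t. t ^ (3 ^ m + 1) = y} = 3 ^ m + 1"
proof -
  have "card {t \<in> UNIV - {0}. t ^ (3 ^ m + 1) = y} = 3 ^ m + 1"
  proof (rule card_fibre_eq[where B = "subfield - {0}"])
    show "card {t \<in> UNIV - {0}. t ^ (3 ^ m + 1) = y} \<le> 3 ^ m + 1" for y :: 'a
      by (rule order.trans[OF card_mono card_power_eq_const_le[of "3 ^ m + 1" y]]) auto
    have "(3 ^ m + 1) * card (subfield - {0}) \<le> (3 ^ m + 1) * (3 ^ m - 1)"
      using card_subfield_star_le by (rule mult_le_mono2)
    also have "\<dots> = card (UNIV - {0 :: 'a})"
      by (simp add: Q_bounds(2) algebra_simps)
    finally show "(3 ^ m + 1) * card (subfield - {0}) \<le> card (UNIV - {0 :: 'a})" .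
    show "(\<lambda>t. t ^ (3 ^ m + 1)) ` (UNIV - {0}) \<subseteq> subfield - {0}"
      using norm_power_Q by (auto simp: subfield_def simp del: power_Suc)
  qed (use assms in auto)
  also have "{t \<in> UNIV - {0}. t ^ (3 ^ m + 1) = y} = {t. t ^ (3 ^ m + 1) = y}"
    using assms by auto
  finally show ?thesis .
qed

text \<open>The fibre count read backwards: Q^2 - 1 nonzero elements in fibres of size Q + 1 require
  at least Q - 1 nonzero norms.\<close>

lemma card_subfield: "card subfield = 3 ^ m"
proof -
  have "card (UNIV - {0 :: 'a}) = (\<Sum>y\<in>subfield - {0}. card {t \<in> UNIV - {0}. t ^ (3 ^ m + 1) = y})"
    by (rule card_eq_sum_fibres)
      (use norm_power_Q in \<open>auto simp: subfield_def simp del: power_Suc\<close>)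
  also have "\<dots> \<le> (\<Sum>y\<in>subfield - {0}. card {t. t ^ (3 ^ m + 1) = y})"
    by (intro sum_mono card_mono) auto
  also have "\<dots> = (\<Sum>y\<in>subfield - {0}. 3 ^ m + 1)"
    by (intro sum.cong refl card_norm_fibre)
  also have "\<dots> = (3 ^ m + 1) * card (subfield - {0})"
    by simp
  finally have "(3 ^ m + 1) * (3 ^ m - 1) \<le> (3 ^ m + 1) * card (subfield - {0})"
    by (simp add: Q_bounds(2) algebra_simps)
  then have "card (subfield - {0}) = 3 ^ m - 1"
    using card_subfield_star_le by (metis add_gr_0 le_antisym mult_le_cancel1 zero_less_one)
  moreover have "card subfield = Suc (card (subfield - {0}))"
    by (rule card.remove) (auto simp: subfield_def)
  ultimately show ?thesis
    by simp
qed

text \<open>On the subfield the conjugates repeat with period \<open>m\<close>, so the long trace is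
  twice the short one, and 2 = -1.\<close>

lemma Tr_subfield:
  assumes "x \<in> subfield"
  shows "Tr x = - tr m x"
proof -
  have "x ^ 3 ^ (i + m) = (x ^ 3 ^ m) ^ 3 ^ i" for i
    by (simp only: power_add power_mult[symmetric] mult.commute)
  then have "x ^ 3 ^ (i + m) = x ^ 3 ^ i" for i
    using assms by (simp add: subfield_def)
  moreover have "(\<Sum>i<m + n. x ^ 3 ^ i) = (\<Sum>i<m. x ^ 3 ^ i) + (\<Sum>i<n. x ^ 3 ^ (i + m))" for n
    by (induction n) (simp_all add: add_ac)
  ultimately have "Tr x = 2 * tr m x"
    by (simp only: tr_def mult_2)
  then show ?thesis
    by (simp only: two_eq_m1) simp
qed

text \<open>Up to sign the trace is a polynomial of degree \<open>3 ^ (m - 1)\<close> on the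
  subfield. Three values share \<open>3 ^ m\<close> elements, so each fibre attains the degree
  bound.\<close>

lemma card_trace_fibre_subfield:
  assumes a: "a \<in> subfield" "a \<noteq> 0" and "c ^ 3 = c"
  shows "card {y \<in> subfield. Tr (a * y) = c} = 3 ^ (m - 1)"
proof (rule card_fibre_eq[where B = "{c. c ^ 3 = c}"])
  show "card {y \<in> subfield. Tr (a * y) = c} \<le> 3 ^ (m - 1)" for c
  proof -
    have "a * y \<in> subfield" if "y \<in> subfield" for y
      using a that by (simp add: subfield_def power_mult_distrib)
    then have "{y \<in> subfield. Tr (a * y) = c} \<subseteq> {y. tr (Suc (m - 1)) (a * y) = - c}"
      using m by (auto simp: Tr_subfield)
    then show ?thesis
      by (rule order.trans[OF card_mono[OF finite] card_tr_eq_const_le[OF a(2)]])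
  qed
  have "(3 :: nat) ^ m = 3 ^ (m - 1) * 3"
    using m by (cases m) auto
  then show "3 ^ (m - 1) * card {c :: 'a. c ^ 3 = c} \<le> card subfield"
    by (simp add: card_prime_field card_subfield)
qed (use assms tr_cube in auto)

text \<open>Counts first the norms \<open>y\<close> of trace \<open>c\<close>, then the preimages of
  each. A nonzero \<open>c\<close> keeps away \<open>y = 0\<close>, whose norm fibre is a single
  point.\<close>

lemma card_norm_form_fibre:
  assumes a: "a \<in> subfield" "a \<noteq> 0" and c: "c ^ 3 = c" "c \<noteq> 0"
  shows "card {t. Tr (a * t ^ (3 ^ m + 1)) = c} = 3 ^ (m - 1) * (3 ^ m + 1)"
proof -
  let ?Y = "{y \<in> subfield. Tr (a * y) = c}"
  have "card {t. Tr (a * t ^ (3 ^ m + 1)) = c}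
      = (\<Sum>y\<in>?Y. card {t \<in> {t. Tr (a * t ^ (3 ^ m + 1)) = c}. t ^ (3 ^ m + 1) = y})"
    by (rule card_eq_sum_fibres)
      (use norm_power_Q in \<open>auto simp: subfield_def simp del: power_Suc\<close>)
  also have "\<dots> = (\<Sum>y\<in>?Y. 3 ^ m + 1)"
  proof (rule sum.cong[OF refl])
    fix y assume y: "y \<in> ?Y"
    then have "{t \<in> {t. Tr (a * t ^ (3 ^ m + 1)) = c}. t ^ (3 ^ m + 1) = y} = {t. t ^ (3 ^ m + 1) = y}"
      by auto
    moreover have "y \<in> subfield - {0}"
      using y c by auto
    ultimately show "card {t \<in> {t. Tr (a * t ^ (3 ^ m + 1)) = c}. t ^ (3 ^ m + 1) = y} = 3 ^ m + 1"
      using card_norm_fibre by metis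
  qed
  finally show ?thesis
    by (simp add: card_trace_fibre_subfield[OF a c(1)])
qed

section \<open>Minimum weight words and blocks\<close>

definition supp :: "'a \<Rightarrow> 'a \<Rightarrow> 'a \<Rightarrow> 'a set" where
  "supp a u \<epsilon> = {t. Tr (a * (t - u) ^ (3 ^ m + 1)) + \<epsilon> \<noteq> 0}"

lemma Q_eqs: "(3 :: nat) ^ m = 3 * 3 ^ (m - 1)" "CARD('a) = 9 * (3 ^ (m - 1) * 3 ^ (m - 1))"
proof -
  show *: "(3 :: nat) ^ m = 3 * 3 ^ (m - 1)"
    using m by (cases m) auto
  show "CARD('a) = 9 * (3 ^ (m - 1) * 3 ^ (m - 1))"
    unfolding Q_bounds(2) * by simp
qed

lemma card_shift:
  fixes u :: 'a
  shows "card {t. P (t - u)} = card {t. P t}"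
  by (rule bij_betw_same_card[of "\<lambda>t. t - u"])
    (auto intro!: bij_betw_byWitness[where f' = "\<lambda>t. t + u"])

text \<open>Put R = 3^(m-1). Each nonzero value is taken R (3 R + 1) times. A constant 1 or -1
  removes one such fibre from the 9 R^2 points; the constant 0 leaves the union of two of
  them.\<close>

lemma card_supp:
  assumes a: "a \<in> subfield" "a \<noteq> 0"
  shows "\<epsilon> \<in> {1, -1} \<Longrightarrow> card (supp a u \<epsilon>) = 6 * (3 ^ (m - 1) * 3 ^ (m - 1)) - 3 ^ (m - 1)"
    and "card (supp a u 0) = 6 * (3 ^ (m - 1) * 3 ^ (m - 1)) + 2 * 3 ^ (m - 1)"
proof -
  let ?R = "3 ^ (m - 1) :: nat"
  let ?f = "\<lambda>t. Tr (a * t ^ (3 ^ m + 1))"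
  have fib: "card {t. ?f t = c} = ?R * (3 * ?R + 1)" if "c ^ 3 = c" "c \<noteq> 0" for c
    using card_norm_form_fibre[OF a that] Q_eqs by simp
  show "card (supp a u \<epsilon>) = 6 * (?R * ?R) - ?R" if "\<epsilon> \<in> {1, -1}"
  proof -
    have "card (supp a u \<epsilon>) = card {t. ?f t + \<epsilon> \<noteq> 0}"
      unfolding supp_def by (rule card_shift[where P = "\<lambda>t. ?f t + \<epsilon> \<noteq> 0"])
    also have "{t. ?f t + \<epsilon> \<noteq> 0} = UNIV - {t. ?f t = - \<epsilon>}"
      by (auto simp: eq_neg_iff_add_eq_0)
    also have "card \<dots> = 9 * (?R * ?R) - ?R * (3 * ?R + 1)"
      using fib[of "- \<epsilon>"] that by (subst card_Diff_subset) (auto simp: Q_eqs(2))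
    finally show ?thesis
      by (simp add: algebra_simps)
  qed
  have "card (supp a u 0) = card {t. ?f t + 0 \<noteq> 0}"
    unfolding supp_def by (rule card_shift[where P = "\<lambda>t. ?f t + 0 \<noteq> 0"])
  also have "{t. ?f t + 0 \<noteq> 0} = {t. ?f t = 1} \<union> {t. ?f t = -1}"
    using prime_field_cases[OF tr_cube] by auto
  also have "card \<dots> = card {t. ?f t = 1} + card {t. ?f t = -1}"
  proof (rule card_Un_disjoint)
    show "{t. ?f t = 1} \<inter> {t. ?f t = -1} = {}"
      using one_neq_m1 by auto
  qed auto
  also have "\<dots> = 2 * (?R * (3 * ?R + 1))"
    using fib[of 1] fib[of "-1"] by simp
  finally show "card (supp a u 0) = 6 * (?R * ?R) + 2 * ?R"
    by (simp add: algebra_simps)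
qed

lemma codeword_eq_0_iff:
  "codeword m a b (h :: 'b) t = 0 \<longleftrightarrow> Tr (a * t ^ (3 ^ m + 1) + b * t) + lift h = 0"
proof -
  have "lift (codeword m a b h t) = Tr (a * t ^ (3 ^ m + 1) + b * t) + lift h"
    unfolding codeword_def lift_add by (simp only: lift_to_F3[OF tr_cube])
  then show ?thesis
    by (metis lift_eq_0_iff)
qed

lemma support_codeword:
  assumes "a \<in> subfield"
  shows "{t. codeword m a (a * u ^ 3 ^ m) (h :: 'b) t \<noteq> 0} = supp a u (lift h - Tr (a * u ^ (3 ^ m + 1)))"
proof -
  have "Tr (a * (t - u) ^ (3 ^ m + 1)) + (lift h - Tr (a * u ^ (3 ^ m + 1)))
      = Tr (a * t ^ (3 ^ m + 1) + a * u ^ 3 ^ m * t) + lift h" for t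
    using complete_square[of a t u] assms by (simp add: subfield_def del: power_Suc)
  then show ?thesis
    unfolding supp_def codeword_eq_0_iff by presburger
qed

lemma prime_field_diff:
  assumes "x ^ 3 = x" "y ^ 3 = (y :: 'a)"
  shows "(x - y) ^ 3 = x - y"
  using power_3_diff[of x y 1] assms by simp

text \<open>For nonzero \<open>a\<close>, completing the square gives a set \<open>supp\<close>
  whose constant is 1 or -1 (minimal) or 0 (larger). For \<open>a = 0\<close> the word is an affine
  trace function with at most 3 R^2 zeros, where R = 3^(m-1), so its weight is at least 6
  R^2.\<close>

lemma codeword_weight_cases:
  assumes "c \<in> (code m :: ('a \<Rightarrow> 'b) set)" "c \<noteq> 0"
  obtains (minimal) a u \<epsilon> where "a \<in> subfield" "a \<noteq> 0" "\<epsilon> \<in> {1, -1}" "{t. c t \<noteq> 0} = supp a u \<epsilon>"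
  | (larger) "wt c > 6 * (3 ^ (m - 1) * 3 ^ (m - 1)) - 3 ^ (m - 1)"
proof -
  obtain a b h where c: "c = codeword m a b h" and a: "a \<in> subfield"
    using assms(1) by (auto simp: code_def subfield_def)
  let ?R = "3 ^ (m - 1) :: nat"
  have R: "?R > 0" "?R * ?R > 0"
    by simp_all
  show thesis
  proof (cases "a = 0")
    case False
    \<comment> \<open>Raising to the power \<open>3 ^ m\<close> is an involution, so this centre
      satisfies \<open>a * ?u ^ 3 ^ m = b\<close>.\<close>
    let ?u = "(b / a) ^ 3 ^ m" and ?\<epsilon> = "lift h - Tr (a * ((b / a) ^ 3 ^ m) ^ (3 ^ m + 1))"
    have "a * ?u ^ 3 ^ m = b"
      using False by (simp add: power_Q_Q)
    then have supp: "{t. c t \<noteq> 0} = supp a ?u ?\<epsilon>"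
      using support_codeword[OF a, of ?u h] by (simp add: c)
    have "?\<epsilon> ^ 3 = ?\<epsilon>"
      by (intro prime_field_diff lift_cube tr_cube)
    then consider "?\<epsilon> = 0" | "?\<epsilon> \<in> {1, -1}"
      using prime_field_cases by blast
    then show thesis
    proof cases
      case 1
      have diff_less_add: "x - y < x + 2 * y" if "y > 0" for x y :: nat
        using that by linarith
      have "wt c > 6 * (?R * ?R) - ?R"
        unfolding wt_def supp 1 card_supp(2)[OF a False] by (rule diff_less_add) simp
      then show thesis
        by (rule larger)
    next
      case 2
      then show thesis
        using minimal a False supp by blast
    qed
  next
    case True
    have supp: "{t. c t \<noteq> 0} = UNIV - {t. Tr (b * t) = - lift h}"
      by (auto simp: c codeword_eq_0_iff True eq_neg_iff_add_eq_0)
    have le: "card {t. Tr (b * t) = - lift h} \<le> 3 * (?R * ?R)"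
    proof (cases "b = 0")
      case True
      have "lift h \<noteq> 0"
      proof
        assume "lift h = 0"
        then have "c = 0"
          using supp True by (auto simp: fun_eq_iff set_eq_iff)
        then show False
          using assms(2) by simp
      qed
      then have "- lift h \<noteq> 0"
        by (metis neg_equal_0_iff_equal)
      then show ?thesis
        using True by simp
    next
      case False
      have "card {t. tr (Suc (2 * m - 1)) (b * t) = - lift h} \<le> 3 ^ (2 * m - 1)"
        by (rule card_tr_eq_const_le[OF False])
      moreover have "Suc (2 * m - 1) = 2 * m" "2 * m - 1 = Suc ((m - 1) + (m - 1))"
        using m by simp_all
      ultimately show ?thesis
        by (simp only: power_Suc power_add)
    qed
    have "wt c = 9 * (?R * ?R) - card {t. Tr (b * t) = - lift h}"
      unfolding wt_def supp by (subst card_Diff_subset) (auto simp: Q_eqs(2))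
    then have "wt c > 6 * (?R * ?R) - ?R"
      using le R by linarith
    then show thesis
      by (rule larger)
  qed
qed

lemma supp_is_support:
  assumes "a \<in> subfield" "\<epsilon> \<in> {1, -1}"
  obtains c :: "'a \<Rightarrow> 'b" where "c \<in> code m" "{t. c t \<noteq> 0} = supp a u \<epsilon>"
proof -
  let ?h = "to_F3 (\<epsilon> + Tr (a * u ^ (3 ^ m + 1))) :: 'b"
  \<comment> \<open>The sum is written with a double minus so that closure of the prime field under
    subtraction applies.\<close>
  have "(\<epsilon> - - Tr (a * u ^ (3 ^ m + 1))) ^ 3 = \<epsilon> - - Tr (a * u ^ (3 ^ m + 1))"
    by (rule prime_field_diff) (use assms tr_cube in \<open>auto simp: power_minus_odd\<close>)
  then have "lift ?h = \<epsilon> + Tr (a * u ^ (3 ^ m + 1))"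
    by (simp add: lift_to_F3)
  then have "{t. codeword m a (a * u ^ 3 ^ m) ?h t \<noteq> 0} = supp a u \<epsilon>"
    unfolding support_codeword[OF assms(1)] by simp
  moreover have "codeword m a (a * u ^ 3 ^ m) ?h \<in> code m"
    using assms by (auto simp: code_def subfield_def)
  ultimately show thesis
    using that by blast
qed

lemma min_distance_pos: "6 * (3 ^ (m - 1) * 3 ^ (m - 1)) - 3 ^ (m - 1) > (0 :: nat)"
proof -
  have "(3 :: nat) ^ (m - 1) > 0" "(3 :: nat) ^ (m - 1) \<le> 3 ^ (m - 1) * 3 ^ (m - 1)"
    by simp_all
  then show ?thesis
    by linarith
qed

lemma min_wt_eq: "min_wt m TYPE('a \<Rightarrow> 'b) = 6 * (3 ^ (m - 1) * 3 ^ (m - 1)) - 3 ^ (m - 1)"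
  unfolding min_wt_def
proof (rule Min_eqI)
  let ?d = "6 * (3 ^ (m - 1) * 3 ^ (m - 1)) - 3 ^ (m - 1) :: nat"
  show "finite {wt c |c :: 'a \<Rightarrow> 'b. c \<in> code m \<and> c \<noteq> 0}"
    by simp
  show "?d \<le> y" if y: "y \<in> {wt c |c :: 'a \<Rightarrow> 'b. c \<in> code m \<and> c \<noteq> 0}" for y
  proof -
    obtain c :: "'a \<Rightarrow> 'b" where c: "y = wt c" "c \<in> code m" "c \<noteq> 0"
      using y by blast
    from c(2,3) show ?thesis
      by (cases rule: codeword_weight_cases) (auto simp: c wt_def card_supp)
  qed
  have one: "1 \<in> subfield"
    by (simp add: subfield_def)
  obtain c :: "'a \<Rightarrow> 'b" where c: "c \<in> code m" "{t. c t \<noteq> 0} = supp 1 0 1"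
    using supp_is_support[OF one, of 1] by blast
  have "wt c = ?d"
    using card_supp(1)[OF one, of 1 0] by (simp add: wt_def c)
  moreover have "?d > 0"
    by (rule min_distance_pos)
  ultimately have "c \<noteq> 0"
    by (auto simp: wt_def)
  with c \<open>wt c = ?d\<close> show "?d \<in> {wt c |c :: 'a \<Rightarrow> 'b. c \<in> code m \<and> c \<noteq> 0}"
    by force
qed

lemma blocks_eq: "blocks m TYPE('a \<Rightarrow> 'b) = {supp a u \<epsilon> |a u \<epsilon>. a \<in> subfield \<and> a \<noteq> 0 \<and> \<epsilon> \<in> {1, -1}}"
proof (intro equalityI subsetI)
  fix B assume "B \<in> blocks m TYPE('a \<Rightarrow> 'b)"
  then obtain c :: "'a \<Rightarrow> 'b" where c: "c \<in> code m" "wt c = min_wt m TYPE('a \<Rightarrow> 'b)" "B = {t. c t \<noteq> 0}"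
    by (auto simp: blocks_def)
  \<comment> \<open>Positivity rules out the zero word, so that the classification of nonzero words
    applies.\<close>
  have "min_wt m TYPE('a \<Rightarrow> 'b) > 0"
    unfolding min_wt_eq by (rule min_distance_pos)
  then have "c \<noteq> 0"
    using c by (auto simp: wt_def)
  with c(1) show "B \<in> {supp a u \<epsilon> |a u \<epsilon>. a \<in> subfield \<and> a \<noteq> 0 \<and> \<epsilon> \<in> {1, -1}}"
    by (cases rule: codeword_weight_cases) (use c min_wt_eq in auto)
next
  fix B assume "B \<in> {supp a u \<epsilon> |a u \<epsilon>. a \<in> subfield \<and> a \<noteq> 0 \<and> \<epsilon> \<in> {1, -1}}"
  then obtain a u \<epsilon> where B: "B = supp a u \<epsilon>" "a \<in> subfield" "a \<noteq> 0" "\<epsilon> \<in> {1, -1}"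
    by blast
  then obtain c :: "'a \<Rightarrow> 'b" where c: "c \<in> code m" "{t. c t \<noteq> 0} = supp a u \<epsilon>"
    using supp_is_support by metis
  have "wt c = min_wt m TYPE('a \<Rightarrow> 'b)"
    using card_supp(1)[of a \<epsilon> u] B by (simp add: wt_def c min_wt_eq)
  then show "B \<in> blocks m TYPE('a \<Rightarrow> 'b)"
    unfolding blocks_def using B c by blast
qed

end

section \<open>The span of the squared forms over the large field\<close>

context ternary_pair
begin

abbreviation nrm :: "'a \<Rightarrow> 'a" where
  "nrm t \<equiv> t ^ (3 ^ m + 1)"

text \<open>These are the incidence vectors of the blocks after lifting: the square of a value in
  {0, 1, -1} is the indicator of being nonzero.\<close>

definition gens :: "('a \<Rightarrow> 'a) set" where
  "gens = {\<lambda>t. (Tr (a * nrm (t - u)) + \<epsilon>) ^ 2 |a u \<epsilon>. a \<in> subfield \<and> a \<noteq> 0 \<and> \<epsilon> \<in> {1, -1}}"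

lemma four_eq_1: "(4 :: 'a) = 1"
proof -
  have "(4 :: 'a) = 3 + 1"
    by simp
  then show ?thesis
    by (simp only: three_eq_0) simp
qed

text \<open>The coefficients \<open>c\<close> and \<open>c ^ 3 ^ m\<close> give the same trace and
  -2 = 1. This passes from subfield coefficients to arbitrary ones, over which coefficient
  extraction must range.\<close>

lemma Tr_nrm_subfield: "Tr (c * nrm t) = Tr (- (c + c ^ 3 ^ m) * nrm t)"
proof -
  have "Tr (c ^ 3 ^ m * nrm t) = Tr ((c * nrm t) ^ 3 ^ m)"
    by (simp only: power_mult_distrib[of c] norm_power_Q)
  then have "Tr (c ^ 3 ^ m * nrm t) = Tr (c * nrm t)"
    by (simp only: Tr_power_Q)
  moreover have "- (c + c ^ 3 ^ m) * nrm t = - (c * nrm t) - c ^ 3 ^ m * nrm t"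
    by (simp add: algebra_simps del: power_Suc)
  ultimately have "Tr (- (c + c ^ 3 ^ m) * nrm t) = - 2 * Tr (c * nrm t)"
    by (simp only: tr_minus tr_diff) simp
  then show ?thesis
    by (simp only: two_eq_m1) simp
qed

lemma subfield_trace: "- (c + c ^ 3 ^ m) \<in> subfield"
  using power_3_diff[of 0 "c + c ^ 3 ^ m" m]
  by (simp add: subfield_def power_3_add power_Q_Q add.commute power_0_left)

text \<open>The difference of the two squares is \<open>4 * f t\<close>, and 4 = 1. Subtracting
  \<open>2 * f t\<close> from the square for \<epsilon> = 1 leaves the second function.\<close>

lemma subspace_sum_of_squares:
  assumes S: "fs.subspace S" and "\<And>\<epsilon>. \<epsilon> \<in> {1, -1} \<Longrightarrow> (\<lambda>t. (f t + \<epsilon>) ^ 2) \<in> S"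
  shows "f \<in> S" and "(\<lambda>t. f t ^ 2 + (1 :: 'a)) \<in> (S :: ('c \<Rightarrow> 'a) set)"
proof -
  have "(\<lambda>t. (f t + 1) ^ 2) - (\<lambda>t. (f t + -1) ^ 2) \<in> S"
    by (intro fs.subspace_diff[OF S] assms) auto
  also have "(\<lambda>t. (f t + 1) ^ 2) - (\<lambda>t. (f t + -1) ^ 2) = (\<lambda>t. 4 * f t)"
    by (simp add: fun_eq_iff power2_eq_square algebra_simps)
  finally show f: "f \<in> S"
    by (simp add: four_eq_1)
  have "(\<lambda>t. (f t + 1) ^ 2) - fscale 2 f \<in> S"
    by (intro fs.subspace_diff[OF S] fs.subspace_scale[OF S] assms f) auto
  also have "(\<lambda>t. (f t + 1) ^ 2) - fscale 2 f = (\<lambda>t. f t ^ 2 + 1)"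
    by (simp add: fun_eq_iff power2_eq_square algebra_simps)
  finally show "(\<lambda>t. f t ^ 2 + 1) \<in> S" .
qed

lemma complete_square':
  assumes "a \<in> subfield"
  shows "Tr (a * nrm (t - u)) = Tr (a * nrm t) + Tr (a * u ^ 3 ^ m * t) + Tr (a * nrm u)"
  using complete_square[of a t u] assms unfolding subfield_def tr_add by blast

text \<open>A second difference in the centre \<open>u\<close>, taken at 1, -1 and 0, cancels the
  quadratic and linear parts in \<open>t\<close> and leaves \<open>2 * Tr a\<close>.\<close>

lemma const_in_span_gens:
  assumes S: "fs.subspace S" and gens: "gens \<subseteq> S"
  shows "(\<lambda>_. c) \<in> S"
proof -
  \<comment> \<open>The trace fibre over 1 has \<open>3 ^ (m - 1)\<close> elements, hence supplies
    an \<open>a\<close> of trace 1.\<close>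
  have "card {y \<in> subfield. Tr (1 * y) = 1} \<noteq> 0"
    by (subst card_trace_fibre_subfield) (auto simp: subfield_def)
  then have "{y \<in> subfield. Tr (1 * y) = 1} \<noteq> {}"
    by (metis card.empty)
  then obtain a where a: "a \<in> subfield" "Tr a = 1"
    by auto
  then have "a \<noteq> 0"
    by auto
  have *: "(\<lambda>t. Tr (a * nrm (t - u))) \<in> S" for u
    by (rule subspace_sum_of_squares[OF S]) (use gens a \<open>a \<noteq> 0\<close> in \<open>auto simp: gens_def\<close>)
  have "fscale 2 ((\<lambda>t. Tr (a * nrm (t - 1))) + (\<lambda>t. Tr (a * nrm (t - (-1)))) - fscale 2 (\<lambda>t. Tr (a * nrm (t - 0)))) \<in> S"
    by (intro fs.subspace_scale[OF S] fs.subspace_diff[OF S] fs.subspace_add[OF S] *)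
  also have "fscale 2 ((\<lambda>t. Tr (a * nrm (t - 1))) + (\<lambda>t. Tr (a * nrm (t - (-1)))) - fscale 2 (\<lambda>t. Tr (a * nrm (t - 0))))
      = (\<lambda>t. 4)"
    unfolding complete_square'[OF a(1)]
    by (simp add: fun_eq_iff a power_minus_odd power_0_left tr_minus del: power_Suc)
  finally have "fscale c (\<lambda>_. 1) \<in> S"
    by (intro fs.subspace_scale[OF S]) (simp add: four_eq_1)
  then show ?thesis
    by (simp add: fscale_def)
qed

lemma trace_forms_in_span_gens_aux:
  assumes S: "fs.subspace S" and gens: "gens \<subseteq> S" and a: "a \<in> subfield" "a \<noteq> 0"
  shows "(\<lambda>t. Tr (a * nrm t)) \<in> S"
    and "(\<lambda>t. Tr (b * t)) \<in> S"
    and "(\<lambda>t. Tr (a * nrm t) ^ 2) \<in> S"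
    and "(\<lambda>t. Tr (a * nrm t) * Tr (b * t)) \<in> S"
    and "(\<lambda>t. Tr (b * t) ^ 2) \<in> S"
proof -
  let ?Q = "\<lambda>t. Tr (a * nrm t)" and ?T = "\<lambda>b t. Tr (b * t)"
  note const = const_in_span_gens[OF S gens]
  \<comment> \<open>The centre \<open>u\<close> is chosen to make the linear part an arbitrary
    \<open>Tr (b * t)\<close>; the constant \<open>k\<close> it introduces is removed using
    constants in \<open>S\<close>.\<close>
  have sum_in: "(\<lambda>t. ?Q t + ?T b t) \<in> S" and sq_in: "(\<lambda>t. (?Q t + ?T b t) ^ 2) \<in> S" for b
  proof -
    define u where "u = (b / a) ^ 3 ^ m"
    have u: "a * u ^ 3 ^ m = b"
      using a by (simp add: u_def power_Q_Q)
    define k where "k = Tr (a * nrm u)"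
    let ?f = "\<lambda>t. ?Q t + ?T b t + k"
    have "(\<lambda>t. (?f t + \<epsilon>) ^ 2) \<in> S" if "\<epsilon> \<in> {1, -1}" for \<epsilon>
    proof -
      have "(\<lambda>t. (Tr (a * nrm (t - u)) + \<epsilon>) ^ 2) \<in> S"
        using gens a that unfolding gens_def by blast
      then show ?thesis
        unfolding complete_square'[OF a(1)] u k_def .
    qed
    note f = subspace_sum_of_squares[OF S this]
    have "?f - (\<lambda>_. k) \<in> S"
      by (intro fs.subspace_diff[OF S] f const)
    also have "?f - (\<lambda>_. k) = (\<lambda>t. ?Q t + ?T b t)"
      by (simp add: fun_eq_iff)
    finally show sum_in: "(\<lambda>t. ?Q t + ?T b t) \<in> S" .
    have "(\<lambda>t. ?f t ^ 2 + 1) - fscale (2 * k) (\<lambda>t. ?Q t + ?T b t) - (\<lambda>_. k ^ 2 + 1) \<in> S"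
      by (intro fs.subspace_diff[OF S] fs.subspace_scale[OF S] f(2) sum_in const)
    also have "(\<lambda>t. ?f t ^ 2 + 1) - fscale (2 * k) (\<lambda>t. ?Q t + ?T b t) - (\<lambda>_. k ^ 2 + 1)
        = (\<lambda>t. (?Q t + ?T b t) ^ 2)"
      by (simp add: fun_eq_iff power2_eq_square algebra_simps)
    finally show "(\<lambda>t. (?Q t + ?T b t) ^ 2) \<in> S" .
  qed
  show Q: "?Q \<in> S"
    using sum_in[of 0] by simp
  show Q2: "(\<lambda>t. ?Q t ^ 2) \<in> S"
    using sq_in[of 0] by simp
  have "(\<lambda>t. ?Q t + ?T b t) - ?Q \<in> S"
    by (intro fs.subspace_diff[OF S] Q sum_in)
  then show "?T b \<in> S"
    by (simp add: fun_diff_def)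
  \<comment> \<open>Changing the sign of \<open>b\<close> flips only the cross term, so the
    difference isolates it with factor 4 = 1.\<close>
  have "(\<lambda>t. (?Q t + ?T b t) ^ 2) - (\<lambda>t. (?Q t + ?T (- b) t) ^ 2) \<in> S"
    by (intro fs.subspace_diff[OF S] sq_in)
  also have "(\<lambda>t. (?Q t + ?T b t) ^ 2) - (\<lambda>t. (?Q t + ?T (- b) t) ^ 2) = (\<lambda>t. 4 * (?Q t * ?T b t))"
    by (simp add: fun_eq_iff power2_eq_square algebra_simps tr_minus)
  finally show QT: "(\<lambda>t. ?Q t * ?T b t) \<in> S"
    by (simp only: four_eq_1) simp
  have "(\<lambda>t. (?Q t + ?T b t) ^ 2) - (\<lambda>t. ?Q t ^ 2) - fscale 2 (\<lambda>t. ?Q t * ?T b t) \<in> S"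
    by (intro fs.subspace_diff[OF S] fs.subspace_scale[OF S] sq_in Q2 QT)
  also have "(\<lambda>t. (?Q t + ?T b t) ^ 2) - (\<lambda>t. ?Q t ^ 2) - fscale 2 (\<lambda>t. ?Q t * ?T b t) = (\<lambda>t. ?T b t ^ 2)"
    by (simp add: fun_eq_iff power2_eq_square algebra_simps)
  finally show "(\<lambda>t. ?T b t ^ 2) \<in> S" .
qed

lemma trace_forms_in_span_gens:
  assumes S: "fs.subspace S" and gens: "gens \<subseteq> S"
  shows "(\<lambda>t. Tr (c * nrm t)) \<in> S"
    and "(\<lambda>t. Tr (b * t)) \<in> S"
    and "(\<lambda>t. Tr (c * nrm t) ^ 2) \<in> S"
    and "(\<lambda>t. Tr (c * nrm t) * Tr (b * t)) \<in> S"
    and "(\<lambda>t. Tr (b * t) ^ 2) \<in> S"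
proof -
  have one: "1 \<in> subfield"
    by (simp add: subfield_def)
  show "(\<lambda>t. Tr (b * t)) \<in> S" "(\<lambda>t. Tr (b * t) ^ 2) \<in> S"
    using trace_forms_in_span_gens_aux(2,5)[OF S gens one] by simp_all
  let ?a = "- (c + c ^ 3 ^ m)"
  have zero: "(\<lambda>_. 0) \<in> S"
    by (rule const_in_span_gens[OF S gens])
  show "(\<lambda>t. Tr (c * nrm t)) \<in> S" "(\<lambda>t. Tr (c * nrm t) ^ 2) \<in> S" "(\<lambda>t. Tr (c * nrm t) * Tr (b * t)) \<in> S"
    \<comment> \<open>The subfield coefficient may vanish although \<open>gens\<close> asks for a
      nonzero one; the forms are then zero and lie in \<open>S\<close> as constants.\<close>
    unfolding Tr_nrm_subfield[of c] atomize_conj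
    by (cases "?a = 0"; (simp only: mult_zero_left tr_0 power_zero_numeral zero simp_thms)?;
        use trace_forms_in_span_gens_aux(1,3,4)[OF S gens subfield_trace[of c]] in blast)
qed

lemma monomials_in_span_gens:
  assumes S: "fs.subspace S" and gens: "gens \<subseteq> S" and i: "i < 2 * m" and j: "j < 2 * m"
  shows "(\<lambda>t. nrm t ^ 3 ^ i * nrm t ^ 3 ^ j) \<in> S"
    and "(\<lambda>t. nrm t ^ 3 ^ i * t ^ 3 ^ j) \<in> S"
    and "(\<lambda>t. t ^ 3 ^ i * t ^ 3 ^ j) \<in> S"
    and "(\<lambda>t. t ^ 3 ^ j) \<in> S"
    and "(\<lambda>_. 1) \<in> S"
proof -
  note forms = trace_forms_in_span_gens[OF S gens]
  show "(\<lambda>t. nrm t ^ 3 ^ i * nrm t ^ 3 ^ j) \<in> S"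
    by (rule tr_coefficient2[OF S _ i j]) (rule tr_square_polarize[OF S forms(3)])
  show "(\<lambda>t. nrm t ^ 3 ^ i * t ^ 3 ^ j) \<in> S"
    by (rule tr_coefficient2[OF S _ i j]) (rule forms(4))
  show "(\<lambda>t. t ^ 3 ^ i * t ^ 3 ^ j) \<in> S"
    by (rule tr_coefficient2[OF S _ i j]) (rule tr_square_polarize[OF S forms(5)])
  show "(\<lambda>t. t ^ 3 ^ j) \<in> S"
    using tr_coefficient[OF S _ j, of "\<lambda>t. t" "\<lambda>_. 1"] forms(2) by simp
  show "(\<lambda>_. 1) \<in> S"
    by (rule const_in_span_gens[OF S gens])
qed

text \<open>The converse direction: after completing the square a generator is (Q + T + k)^2, with
  \<epsilon> absorbed in \<open>k\<close>, and its expansion involves only traces of the listed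
  functions.\<close>

lemma gens_subset:
  assumes S: "fs.subspace S"
    and NN: "\<And>i j. i < 2 * m \<Longrightarrow> j < 2 * m \<Longrightarrow> (\<lambda>t. nrm t ^ 3 ^ i * nrm t ^ 3 ^ j) \<in> S"
    and Nt: "\<And>i j. i < 2 * m \<Longrightarrow> j < 2 * m \<Longrightarrow> (\<lambda>t. nrm t ^ 3 ^ i * t ^ 3 ^ j) \<in> S"
    and tt: "\<And>i j. i < 2 * m \<Longrightarrow> j < 2 * m \<Longrightarrow> (\<lambda>t. t ^ 3 ^ i * t ^ 3 ^ j) \<in> S"
    and N: "\<And>i. i < 2 * m \<Longrightarrow> (\<lambda>t. nrm t ^ 3 ^ i) \<in> S"
    and t: "\<And>i. i < 2 * m \<Longrightarrow> (\<lambda>t. t ^ 3 ^ i) \<in> S"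
    and one: "(\<lambda>_. 1) \<in> S"
  shows "gens \<subseteq> S"
proof
  fix f assume "f \<in> gens"
  then obtain a u \<epsilon> where f: "f = (\<lambda>t. (Tr (a * nrm (t - u)) + \<epsilon>) ^ 2)" and a: "a \<in> subfield"
    unfolding gens_def by blast
  define b k where "b = a * u ^ 3 ^ m" and "k = Tr (a * nrm u) + \<epsilon>"
  let ?Q = "\<lambda>t. Tr (a * nrm t)" and ?T = "\<lambda>t. Tr (b * t)"
  have "(\<lambda>t. ?Q t * ?Q t) + (\<lambda>t. ?T t * ?T t) + fscale 2 (\<lambda>t. ?Q t * ?T t)
      + fscale (2 * k) ?Q + fscale (2 * k) ?T + fscale (k ^ 2) (\<lambda>_. 1) \<in> S"
    by (intro fs.subspace_add[OF S] fs.subspace_scale[OF S] tr_product_in[OF S] tr_in[OF S] assms)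
  also have "(\<lambda>t. ?Q t * ?Q t) + (\<lambda>t. ?T t * ?T t) + fscale 2 (\<lambda>t. ?Q t * ?T t)
      + fscale (2 * k) ?Q + fscale (2 * k) ?T + fscale (k ^ 2) (\<lambda>_. 1) = (\<lambda>t. (?Q t + ?T t + k) ^ 2)"
    by (simp add: fun_eq_iff power2_eq_square algebra_simps)
  also have "\<dots> = f"
    unfolding f complete_square'[OF a] b_def k_def by (simp only: add.assoc)
  finally show "f \<in> S" .
qed

end

section \<open>Ternary digits and the count of exponents\<close>

text \<open>Multisets of digit positions encode exponents that are sums of powers of 3: the
  multiplicity of \<open>k\<close> is the digit at position \<open>k\<close>, provided it is below
  3.\<close>

definition ternary_value :: "nat multiset \<Rightarrow> nat" where
  "ternary_value M = (\<Sum>k\<in>#M. 3 ^ k)"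

lemma ternary_value_simps [simp]:
  "ternary_value {#} = 0"
  "ternary_value (add_mset k M) = 3 ^ k + ternary_value M"
  by (simp_all add: ternary_value_def)

lemma ternary_digits_unique:
  fixes d d' :: "nat \<Rightarrow> nat"
  assumes "(\<Sum>i<n. d i * 3 ^ i) = (\<Sum>i<n. d' i * 3 ^ i)"
    and "\<And>i. d i < 3" "\<And>i. d' i < 3" and "i < n"
  shows "d i = d' i"
  using assms
proof (induction n arbitrary: d d' i)
  case (Suc n)
  have split: "(\<Sum>i<Suc n. f i * 3 ^ i) = f 0 + 3 * (\<Sum>i<n. f (Suc i) * 3 ^ i)" for f :: "nat \<Rightarrow> nat"
    by (simp only: sum.lessThan_Suc_shift) (simp add: sum_distrib_left mult_ac)
  have eq: "d 0 + 3 * (\<Sum>i<n. d (Suc i) * 3 ^ i) = d' 0 + 3 * (\<Sum>i<n. d' (Suc i) * 3 ^ i)"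
    using Suc.prems(1) unfolding split .
  moreover have "d 0 < 3" "d' 0 < 3"
    using Suc.prems by auto
  ultimately have "d 0 = d' 0" and "(\<Sum>i<n. d (Suc i) * 3 ^ i) = (\<Sum>i<n. d' (Suc i) * 3 ^ i)"
    by presburger+
  then show ?case
    using Suc.IH[of "\<lambda>i. d (Suc i)" "\<lambda>i. d' (Suc i)"] Suc.prems by (cases i) auto
qed simp

lemma ternary_value_eq_sum_count:
  "set_mset M \<subseteq> {..<n} \<Longrightarrow> ternary_value M = (\<Sum>k<n. count M k * 3 ^ k)"
proof (induction M)
  case (add x M)
  have "(\<Sum>k<n. count (add_mset x M) k * 3 ^ k)
      = (\<Sum>k<n. count M k * 3 ^ k + (if k = x then 3 ^ x else 0))"
    by (intro sum.cong) auto
  then show ?case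
    using add by (simp add: sum.distrib)
qed simp

lemma inj_on_ternary_value: "inj_on ternary_value {M. set_mset M \<subseteq> {..<n} \<and> (\<forall>k. count M k < 3)}"
proof (rule inj_onI)
  fix M M'
  assume M: "M \<in> {M. set_mset M \<subseteq> {..<n} \<and> (\<forall>k. count M k < 3)}"
    and M': "M' \<in> {M. set_mset M \<subseteq> {..<n} \<and> (\<forall>k. count M k < 3)}"
    and "ternary_value M = ternary_value M'"
  then have "(\<Sum>k<n. count M k * 3 ^ k) = (\<Sum>k<n. count M' k * 3 ^ k)"
    by (simp add: ternary_value_eq_sum_count[of _ n, symmetric])
  then have "count M k = count M' k" if "k < n" for k
    by (rule ternary_digits_unique[OF _ _ _ that]) (use M M' in auto)
  moreover have "count M k = 0" "count M' k = 0" if "\<not> k < n" for k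
    using M M' that by (auto simp: not_in_iff[symmetric])
  ultimately have "count M k = count M' k" for k
    by (cases "k < n") auto
  then show "M = M'"
    by (rule multiset_eqI)
qed

text \<open>The order condition selects one representative of each unordered pair, equal entries
  included.\<close>

definition pairs :: "nat \<Rightarrow> (nat \<times> nat) set" where
  "pairs n = (SIGMA l:{..<n}. {..l})"

lemma finite_pairs [simp]: "finite (pairs n)"
  by (simp add: pairs_def)

lemma card_pairs: "2 * card (pairs n) = n * (n + 1)"
proof -
  have "2 * (\<Sum>l<n. Suc l) = n * (n + 1)"
    by (induction n) auto
  then show ?thesis
    by (simp add: pairs_def)
qed

lemma pair_multiset_inj:
  fixes k k' l l' :: nat
  assumes "{#k, l#} = {#k', l'#}" "l \<le> k" "l' \<le> k'"
  shows "k = k' \<and> l = l'"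
  using assms by (auto simp: add_eq_conv_ex add_mset_eq_single)

lemma obtain_pair:
  fixes k l :: nat
  assumes "k < n" "l < n"
  obtains x y where "(x, y) \<in> pairs n" "{#k, l#} = {#x, y#}"
proof (cases "l \<le> k")
  case True
  then show thesis
    using assms by (intro that[of k l]) (auto simp: pairs_def)
next
  case False
  then show thesis
    using assms by (intro that[of l k]) (auto simp: pairs_def add_mset_commute)
qed

text \<open>The families \<open>digits1\<close> to \<open>digits4\<close> stand for linear terms,
  products of two linear terms, norm times linear term, and norm times norm. A conjugate of the norm
  contributes the positions \<open>i\<close> and \<open>i + m\<close>; a norm alone already occurs
  in \<open>digits2\<close>.\<close>

definition digits1 :: "nat \<Rightarrow> nat multiset set" where
  "digits1 m = (\<lambda>k. {#k#}) ` {..<2 * m}"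

definition digits2 :: "nat \<Rightarrow> nat multiset set" where
  "digits2 m = (\<lambda>(k, l). {#k, l#}) ` pairs (2 * m)"

definition digits3 :: "nat \<Rightarrow> nat multiset set" where
  "digits3 m = (\<lambda>(i, k). {#i, i + m, k#}) ` ({..<m} \<times> {..<2 * m})"

definition digits4 :: "nat \<Rightarrow> nat multiset set" where
  "digits4 m = (\<lambda>(i, j). {#i, i + m, j, j + m#}) ` pairs m"

definition digits :: "nat \<Rightarrow> nat multiset set" where
  "digits m = {{#}} \<union> digits1 m \<union> digits2 m \<union> digits3 m \<union> digits4 m"

lemmas digits_defs = digits_def digits1_def digits2_def digits3_def digits4_def

lemma digits_intros:
  "{#} \<in> digits m"
  "k < 2 * m \<Longrightarrow> {#k#} \<in> digits m"
  "(k, l) \<in> pairs (2 * m) \<Longrightarrow> {#k, l#} \<in> digits m"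
  "i < m \<Longrightarrow> k < 2 * m \<Longrightarrow> {#i, i + m, k#} \<in> digits m"
  "(i, j) \<in> pairs m \<Longrightarrow> {#i, i + m, j, j + m#} \<in> digits m"
  using imageI[of "(k, l)" "pairs (2 * m)" "\<lambda>(k, l). {#k, l#}"]
    imageI[of "(i, k)" "{..<m} \<times> {..<2 * m}" "\<lambda>(i, k). {#i, i + m, k#}"]
    imageI[of "(i, j)" "pairs m" "\<lambda>(i, j). {#i, i + m, j, j + m#}"]
  unfolding digits_defs prod.case by blast+

lemma card_digits1: "card (digits1 m) = 2 * m"
  unfolding digits1_def by (subst card_image) (auto intro: inj_onI)

lemma card_digits2: "card (digits2 m) = card (pairs (2 * m))"
  unfolding digits2_def
proof (rule card_image, rule inj_onI)
  fix p p' assume "p \<in> pairs (2 * m)" "p' \<in> pairs (2 * m)"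
    and eq: "(case p of (k, l) \<Rightarrow> {#k, l#}) = (case p' of (k, l) \<Rightarrow> {#k, l#})"
  then obtain k l k' l' where p: "p = (k, l)" "p' = (k', l')" and le: "l \<le> k" "l' \<le> k'"
    by (auto simp: pairs_def)
  have "{#k, l#} = {#k', l'#}"
    using eq unfolding p by simp
  from pair_multiset_inj[OF this le] show "p = p'"
    unfolding p by simp
qed

lemma card_digits3: "card (digits3 m) = m * (2 * m)"
proof -
  have "inj_on (\<lambda>(i, k). {#i, i + m, k#}) ({..<m} \<times> {..<2 * m})"
  proof (rule inj_onI)
    fix p p' assume "p \<in> {..<m} \<times> {..<2 * m}" "p' \<in> {..<m} \<times> {..<2 * m}"
      and eq: "(case p of (i, k) \<Rightarrow> {#i, i + m, k#}) = (case p' of (i, k) \<Rightarrow> {#i, i + m, k#})"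
    then obtain i k i' k' where p: "p = (i, k)" "p' = (i', k')" and less: "i < m" "i' < m"
      by auto
    have eq': "{#i, i + m, k#} = {#i', i' + m, k'#}"
      using eq unfolding p by (simp only: prod.case)
    then have "set_mset {#i, i + m, k#} = set_mset {#i', i' + m, k'#}"
      by (rule arg_cong)
    then have "{i, i + m, k} = {i', i' + m, k'}"
      by (simp only: set_mset_add_mset_insert set_mset_empty)
    \<comment> \<open>If \<open>i\<close> and \<open>i'\<close> differed, both \<open>i\<close> and
      \<open>i + m\<close> would have to equal the single element \<open>k'\<close>.\<close>
    then have "i = i' \<or> i = i' + m \<or> i = k'" "i + m = i' \<or> i + m = i' + m \<or> i + m = k'"
      by blast+
    then have "i = i'"
      using less by linarith
    have "k = k'"
      using eq' unfolding \<open>i = i'\<close> by simp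
    with \<open>i = i'\<close> show "p = p'"
      unfolding p by simp
  qed
  then show ?thesis
    unfolding digits3_def by (simp add: card_image)
qed

lemma card_digits4: "card (digits4 m) = card (pairs m)"
  unfolding digits4_def
proof (rule card_image, rule inj_onI)
  fix p p' assume "p \<in> pairs m" "p' \<in> pairs m"
    and eq: "(case p of (i, j) \<Rightarrow> {#i, i + m, j, j + m#}) = (case p' of (i, j) \<Rightarrow> {#i, i + m, j, j + m#})"
  then obtain i j i' j' where p: "p = (i, j)" "p' = (i', j')"
    and le: "i < m" "j \<le> i" "i' < m" "j' \<le> i'"
    by (auto simp: pairs_def)
  \<comment> \<open>The positions below \<open>m\<close> are exactly \<open>i\<close> and
    \<open>j\<close>, so they recover the pair.\<close>
  have "filter_mset (\<lambda>x. x < m) {#i, i + m, j, j + m#} = filter_mset (\<lambda>x. x < m) {#i', i' + m, j', j' + m#}"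
    using eq unfolding p prod.case by (rule arg_cong)
  then have "{#i, j#} = {#i', j'#}"
    using le by simp
  from pair_multiset_inj[OF this le(2,4)] show "p = p'"
    unfolding p by simp
qed

text \<open>The five families have sizes 0 to 4 and are therefore disjoint. Doubling the count
  avoids the halves in the numbers of pairs.\<close>

lemma card_digits: "card (digits m) = (9 * m ^ 2 + 7 * m) div 2 + 1"
proof -
  have size: "M \<in> digits1 m \<Longrightarrow> size M = 1" "M \<in> digits2 m \<Longrightarrow> size M = 2"
    "M \<in> digits3 m \<Longrightarrow> size M = 3" "M \<in> digits4 m \<Longrightarrow> size M = 4" for M
    by (auto simp: digits_defs)
  have "finite (digits1 m)" "finite (digits2 m)" "finite (digits3 m)" "finite (digits4 m)"
    by (auto simp: digits_defs)
  moreover have "({{#}} \<union> digits1 m \<union> digits2 m \<union> digits3 m) \<inter> digits4 m = {}"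
    "({{#}} \<union> digits1 m \<union> digits2 m) \<inter> digits3 m = {}"
    "({{#}} \<union> digits1 m) \<inter> digits2 m = {}" "{{#}} \<inter> digits1 m = {}"
    by (fastforce dest: size)+
  ultimately have "card (digits m) = 1 + card (digits1 m) + card (digits2 m) + card (digits3 m) + card (digits4 m)"
    unfolding digits_def by (simp add: card_Un_disjoint)
  then have "2 * card (digits m) = 2 + 4 * m + 2 * card (pairs (2 * m)) + 4 * m * m + 2 * card (pairs m)"
    by (simp add: card_digits1 card_digits2 card_digits3 card_digits4)
  also have "\<dots> = 9 * m ^ 2 + 7 * m + 2"
    unfolding card_pairs by (simp add: power2_eq_square algebra_simps)
  finally show ?thesis
    by linarith
qed

lemma digits_cases:
  assumes "M \<in> digits m"
  obtains (0) "M = {#}"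
  | (1) k where "k < 2 * m" "M = {#k#}"
  | (2) k l where "k < 2 * m" "l < 2 * m" "M = {#k, l#}"
  | (3) i k where "i < m" "k < 2 * m" "M = {#i, i + m, k#}"
  | (4) i j where "i < m" "j < m" "M = {#i, i + m, j, j + m#}"
proof -
  from assms consider "M = {#}" | "M \<in> digits1 m" | "M \<in> digits2 m" | "M \<in> digits3 m" | "M \<in> digits4 m"
    by (auto simp: digits_def)
  then show thesis
  proof cases
    assume "M \<in> digits2 m"
    then obtain p where "p \<in> pairs (2 * m)" "M = (case p of (k, l) \<Rightarrow> {#k, l#})"
      unfolding digits2_def by (rule imageE)
    then show thesis
      by (intro 2[of "fst p" "snd p"]) (auto simp only: pairs_def prod.case prod.sel mem_Sigma_iff lessThan_iff atMost_iff split: prod.splits)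
  next
    assume "M \<in> digits3 m"
    then obtain p where "p \<in> {..<m} \<times> {..<2 * m}" "M = (case p of (i, k) \<Rightarrow> {#i, i + m, k#})"
      unfolding digits3_def by (rule imageE)
    then show thesis
      by (intro 3[of "fst p" "snd p"]) (auto simp only: prod.case prod.sel mem_Sigma_iff lessThan_iff split: prod.splits)
  next
    assume "M \<in> digits4 m"
    then obtain p where "p \<in> pairs m" "M = (case p of (i, j) \<Rightarrow> {#i, i + m, j, j + m#})"
      unfolding digits4_def by (rule imageE)
    then show thesis
      by (intro 4[of "fst p" "snd p"]) (auto simp only: pairs_def prod.case prod.sel mem_Sigma_iff lessThan_iff atMost_iff split: prod.splits)
  qed (use 0 1 in \<open>auto simp: digits1_def\<close>)
qed

text \<open>For positive \<open>m\<close> the positions \<open>i\<close> and \<open>i + m\<close>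
  differ, so no position occurs more than twice and the multiset is a true ternary
  expansion.\<close>

lemma digits_subset:
  assumes "m > 0"
  shows "digits m \<subseteq> {M. set_mset M \<subseteq> {..<2 * m} \<and> (\<forall>k. count M k < 3)}"
  using assms by (auto simp: digits_defs pairs_def)

text \<open>With T = 3^(2m-2), any digit position contributes at most 3 T and one below
  \<open>m\<close> at most T. The worst case is two norm factors: 3 T + 3 T + T + T.\<close>

lemma ternary_value_digits_le:
  assumes "m \<ge> 2" and "M \<in> digits m"
  shows "ternary_value M \<le> 8 * 3 ^ (2 * m - 2)"
proof -
  define T :: nat where "T = 3 ^ (2 * m - 2)"
  have large: "(3 :: nat) ^ k \<le> 3 * T" if "k < 2 * m" for k
  proof -
    have "(3 :: nat) ^ k \<le> 3 ^ Suc (2 * m - 2)"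
      using that assms by (intro power_increasing) auto
    then show ?thesis
      by (simp add: T_def)
  qed
  have small: "(3 :: nat) ^ k \<le> T" if "k < m" for k
    unfolding T_def using that assms by (intro power_increasing) auto
  have "ternary_value M \<le> 8 * T"
    using assms(2)
  proof (cases rule: digits_cases)
    case (1 k)
    then show ?thesis
      using large[of k] by simp
  next
    case (2 k l)
    then show ?thesis
      using large[of k] large[of l] by simp
  next
    case (3 i k)
    then show ?thesis
      using large[of k] large[of "i + m"] small[of i] by simp
  next
    case (4 i j)
    then show ?thesis
      using large[of "i + m"] large[of "j + m"] small[of i] small[of j] by simp
  qed simp
  then show ?thesis
    by (simp only: T_def)
qed

section \<open>Spans of monomial functions\<close>

lemma fs_subspace_poly_degree_le:
  "fs.subspace {\<lambda>t. poly p t |p :: 'a::field poly. degree p \<le> n}"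
proof (rule fs.subspaceI)
  show "0 \<in> {\<lambda>t. poly p t |p :: 'a poly. degree p \<le> n}"
    by (intro CollectI exI[of _ 0]) (auto simp: fun_eq_iff)
next
  fix x y
  assume "x \<in> {\<lambda>t. poly p t |p :: 'a poly. degree p \<le> n}" "y \<in> {\<lambda>t. poly p t |p :: 'a poly. degree p \<le> n}"
  then obtain p q where "x = (\<lambda>t. poly p t)" "y = (\<lambda>t. poly q t)" "degree p \<le> n" "degree q \<le> n"
    by blast
  then show "x + y \<in> {\<lambda>t. poly p t |p :: 'a poly. degree p \<le> n}"
    by (intro CollectI exI[of _ "p + q"]) (auto simp: fun_eq_iff degree_add_le)
next
  fix c x
  assume "x \<in> {\<lambda>t. poly p t |p :: 'a poly. degree p \<le> n}"
  then obtain p where "x = (\<lambda>t. poly p t)" "degree p \<le> n"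
    by blast
  then show "fscale c x \<in> {\<lambda>t. poly p t |p :: 'a poly. degree p \<le> n}"
    by (intro CollectI exI[of _ "smult c p"]) (auto simp: fun_eq_iff intro: order.trans[OF degree_smult_le])
qed

lemma card_zeros_span_monomials_le:
  assumes "E \<subseteq> {..n}" and "v \<in> fs.span ((\<lambda>e t. t ^ e) ` E)" and "v \<noteq> (0 :: 'a::field \<Rightarrow> 'a)"
  shows "card {t. v t = 0} \<le> n"
proof -
  have "(\<lambda>e t. t ^ e) ` E \<subseteq> {\<lambda>t. poly p t |p :: 'a poly. degree p \<le> n}"
  proof
    fix f :: "'a \<Rightarrow> 'a" assume "f \<in> (\<lambda>e t. t ^ e) ` E"
    then obtain e where "e \<le> n" "f = (\<lambda>t. t ^ e)"
      using assms(1) by blast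
    then show "f \<in> {\<lambda>t. poly p t |p :: 'a poly. degree p \<le> n}"
      by (intro CollectI exI[of _ "monom 1 e"]) (auto simp: poly_monom degree_monom_eq)
  qed
  from fs.span_minimal[OF this fs_subspace_poly_degree_le] assms(2)
  obtain p where p: "v = (\<lambda>t. poly p t)" "degree p \<le> n"
    by blast
  then have "p \<noteq> 0"
    using assms(3) by (auto simp: fun_eq_iff)
  then show ?thesis
    using card_poly_roots_bound[of p] p by simp
qed

text \<open>A polynomial of degree below the field size that vanishes at every element is zero, so
  distinct exponents in this range give independent functions.\<close>

lemma independent_monomials:
  assumes "E \<subseteq> {..<CARD('a::{field,finite})}"
  shows "fs.independent ((\<lambda>e (t :: 'a). t ^ e) ` E)" and "inj_on (\<lambda>e (t :: 'a). t ^ e) E"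
proof -
  let ?mono = "\<lambda>e (t :: 'a). t ^ e"
  have zero: "p = 0" if "degree p < CARD('a)" "\<And>t. poly p t = 0" for p :: "'a poly"
    using card_poly_roots_bound[of p] that by auto
  show inj: "inj_on ?mono E"
  proof (rule inj_onI)
    fix e e' assume e: "e \<in> E" "e' \<in> E" "?mono e = ?mono e'"
    have "degree (monom 1 e - monom 1 e' :: 'a poly) < CARD('a)"
      using e(1,2) assms by (intro degree_diff_less) (auto simp: degree_monom_eq)
    then have "monom 1 e - monom 1 e' = (0 :: 'a poly)"
      by (rule zero) (use e(3) in \<open>auto simp: poly_monom fun_eq_iff\<close>)
    then show "e = e'"
      by (metis degree_monom_eq eq_iff_diff_eq_0 one_neq_zero)
  qed
  have fin: "finite E"
    using assms finite_subset by blast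
  show "fs.independent (?mono ` E)"
  proof (rule fs.independent_if_scalars_zero)
    fix f x assume f: "(\<Sum>x\<in>?mono ` E. fscale (f x) x) = 0" and "x \<in> ?mono ` E"
    then obtain e where e: "e \<in> E" "x = ?mono e"
      by blast
    let ?p = "\<Sum>e\<in>E. monom (f (?mono e)) e"
    have "poly ?p t = (\<Sum>x\<in>?mono ` E. fscale (f x) x) t" for t
      by (simp add: sum_fun_apply poly_sum poly_monom sum.reindex[OF inj])
    then have "poly ?p t = 0" for t
      using f by simp
    moreover have "degree ?p < CARD('a)"
    proof -
      have "degree ?p \<le> CARD('a) - 1"
        using assms by (intro degree_sum_le fin) (force intro: order.trans[OF degree_monom_le])
      then show ?thesis
        using zero_less_card_finite[where 'a = 'a] by linarith
    qed
    ultimately have "?p = 0"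
      by (intro zero)
    then have "coeff ?p e = 0"
      by simp
    then show "f x = 0"
      using e fin by (simp add: coeff_sum)
  qed (use fin in simp)
qed

section \<open>Monomial basis and dimension over the large field\<close>

context ternary_pair
begin

abbreviation monomials :: "('a \<Rightarrow> 'a) set" where
  "monomials \<equiv> (\<lambda>e t. t ^ e) ` ternary_value ` digits m"

lemma nrm_power_3: "nrm t ^ 3 ^ i = t ^ 3 ^ i * t ^ 3 ^ (i + m)"
proof -
  have "nrm t ^ 3 ^ i = t ^ ((3 ^ m + 1) * 3 ^ i)"
    by (simp only: power_mult)
  also have "(3 ^ m + 1) * 3 ^ i = (3 :: nat) ^ i + 3 ^ (i + m)"
    by (simp add: power_add algebra_simps)
  finally show ?thesis
    by (simp only: power_add)
qed

text \<open>Norms are fixed by raising to the power \<open>3 ^ m\<close>, so the exponent index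
  matters only modulo \<open>m\<close>.\<close>

lemma nrm_power_3_reduce:
  assumes "i < 2 * m"
  obtains j where "j < m" "\<And>t :: 'a. nrm t ^ 3 ^ i = nrm t ^ 3 ^ j"
proof (cases "i < m")
  case False
  have "nrm t ^ 3 ^ i = nrm t ^ 3 ^ (i - m)" for t :: 'a
  proof -
    have "(3 :: nat) ^ i = 3 ^ m * 3 ^ (i - m)"
      using False by (simp flip: power_add)
    then have "nrm t ^ 3 ^ i = (nrm t ^ 3 ^ m) ^ 3 ^ (i - m)"
      by (simp only: power_mult)
    then show ?thesis
      by (simp only: norm_power_Q)
  qed
  then show thesis
    using assms False by (intro that[of "i - m"]) auto
qed (use that in blast)

lemma monomial_in_span:
  assumes "M \<in> digits m"
  shows "(\<lambda>t. t ^ ternary_value M) \<in> fs.span monomials"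
  by (rule fs.span_base) (use assms in blast)

lemma span_gens_eq: "fs.span gens = fs.span monomials"
proof
  have tt: "(\<lambda>t. t ^ 3 ^ i * t ^ 3 ^ j) \<in> fs.span monomials" if ij: "i < 2 * m" "j < 2 * m" for i j
  proof -
    obtain x y where "(x, y) \<in> pairs (2 * m)" and eq: "{#i, j#} = {#x, y#}"
      using obtain_pair[OF ij] by blast
    then have "{#i, j#} \<in> digits m"
      using digits_intros(3) by simp
    from monomial_in_span[OF this] show ?thesis
      by (simp add: power_add)
  qed
  have t: "(\<lambda>t. t ^ 3 ^ i) \<in> fs.span monomials" if "i < 2 * m" for i
    using monomial_in_span[OF digits_intros(2)[OF that]] by simp
  have one: "(\<lambda>_. 1) \<in> fs.span monomials"
    using monomial_in_span[OF digits_intros(1)] by simp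
  have N: "(\<lambda>t. nrm t ^ 3 ^ i) \<in> fs.span monomials" if i: "i < 2 * m" for i
  proof -
    from i obtain j where j: "j < m" "\<And>t :: 'a. nrm t ^ 3 ^ i = nrm t ^ 3 ^ j"
      using nrm_power_3_reduce by blast
    show ?thesis
      \<comment> \<open>A conjugate of the norm is itself a product of two linear monomials, at
        positions \<open>j\<close> and \<open>j + m\<close>.\<close>
      unfolding j(2) unfolding nrm_power_3 using j(1) by (intro tt) auto
  qed
  have Nt: "(\<lambda>t. nrm t ^ 3 ^ i * t ^ 3 ^ k) \<in> fs.span monomials" if i: "i < 2 * m" and k: "k < 2 * m" for i k
  proof -
    from i obtain j where j: "j < m" "\<And>t :: 'a. nrm t ^ 3 ^ i = nrm t ^ 3 ^ j"
      using nrm_power_3_reduce by blast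
    have "{#j, j + m, k#} \<in> digits m"
      using j(1) k by (rule digits_intros(4))
    from monomial_in_span[OF this] show ?thesis
      unfolding j(2) unfolding nrm_power_3 by (simp add: power_add mult.assoc)
  qed
  have NN: "(\<lambda>t. nrm t ^ 3 ^ i * nrm t ^ 3 ^ k) \<in> fs.span monomials" if i: "i < 2 * m" and k: "k < 2 * m" for i k
  proof -
    from i obtain j where j: "j < m" "\<And>t :: 'a. nrm t ^ 3 ^ i = nrm t ^ 3 ^ j"
      using nrm_power_3_reduce by blast
    from k obtain l where l: "l < m" "\<And>t :: 'a. nrm t ^ 3 ^ k = nrm t ^ 3 ^ l"
      using nrm_power_3_reduce by blast
    have in_span: "(\<lambda>t. nrm t ^ 3 ^ x * nrm t ^ 3 ^ y) \<in> fs.span monomials" if "(x, y) \<in> pairs m" for x y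
    proof -
      have "{#x, x + m, y, y + m#} \<in> digits m"
        using that by (rule digits_intros(5))
      from monomial_in_span[OF this] show ?thesis
        unfolding nrm_power_3 by (simp add: power_add mult.assoc)
    qed
    have "(j, l) \<in> pairs m \<or> (l, j) \<in> pairs m"
      using j(1) l(1) by (auto simp: pairs_def)
    then show ?thesis
      unfolding j(2) l(2) using in_span[of j l] in_span[of l j] by (auto simp: mult.commute)
  qed
  show "fs.span gens \<subseteq> fs.span monomials"
    by (intro fs.span_minimal gens_subset fs.subspace_span tt t one N Nt NN)
next
  note mem = monomials_in_span_gens[OF fs.subspace_span fs.span_superset[of gens]]
  have zero: "0 < 2 * m"
    using m by simp
  have "(\<lambda>t. t ^ ternary_value M) \<in> fs.span gens" if "M \<in> digits m" for M
  proof -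
    from that show ?thesis
    proof (cases rule: digits_cases)
      case 0
      then show ?thesis
        using mem(5)[OF zero zero] by simp
    next
      case (1 k)
      then show ?thesis
        using mem(4)[OF zero, of k] by simp
    next
      case (2 k l)
      then show ?thesis
        using mem(3)[of k l] by (simp add: power_add)
    next
      case (3 i k)
      then show ?thesis
        using mem(2)[of i k, unfolded nrm_power_3] by (simp add: power_add mult.assoc)
    next
      case (4 i j)
      then show ?thesis
        using mem(1)[of i j, unfolded nrm_power_3] by (simp add: power_add mult.assoc)
    qed
  qed
  then show "fs.span monomials \<subseteq> fs.span gens"
    by (intro fs.span_minimal fs.subspace_span) blast
qed

lemma exponents_le: "ternary_value ` digits m \<subseteq> {..8 * 3 ^ (2 * m - 2)}"
  using ternary_value_digits_le[OF m] by blast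

lemma CARD_eq_9: "CARD('a) = 9 * 3 ^ (2 * m - 2)"
proof -
  have "2 * m = Suc (Suc (2 * m - 2))"
    using m by simp
  then have "(3 :: nat) ^ (2 * m) = 3 ^ Suc (Suc (2 * m - 2))"
    by (rule arg_cong)
  then show ?thesis
    by (simp add: card)
qed

text \<open>All exponents lie below the field size, so the monomials are independent, and digit
  multisets correspond one to one to exponents.\<close>

lemma dim_span_gens: "fs.dim (fs.span gens) = (9 * m ^ 2 + 7 * m) div 2 + 1"
proof -
  have "8 * 3 ^ (2 * m - 2) < CARD('a)"
    unfolding CARD_eq_9 by simp
  then have E: "ternary_value ` digits m \<subseteq> {..<CARD('a)}"
    using exponents_le by force
  have "inj_on ternary_value (digits m)"
    by (rule inj_on_subset[OF inj_on_ternary_value digits_subset]) (use m in simp)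
  then have "card monomials = card (digits m)"
    using independent_monomials(2)[OF E] by (simp add: card_image)
  then show ?thesis
    using fs.dim_span_eq_card_independent[OF independent_monomials(1)[OF E]]
    by (simp only: span_gens_eq card_digits)
qed

section \<open>Descent to the field of order three\<close>

definition lift_fun :: "('a \<Rightarrow> 'b) \<Rightarrow> ('a \<Rightarrow> 'a)" where
  "lift_fun v = (\<lambda>t. lift (v t))"

lemma inj_lift_fun: "inj lift_fun"
  by (rule injI) (auto simp: lift_fun_def fun_eq_iff)

lemma subspace_lift_fun_vimage:
  assumes "fs.subspace S"
  shows "fs.subspace (lift_fun -` S)"
proof (rule fs.subspaceI)
  show "0 \<in> lift_fun -` S"
    using fs.subspace_0[OF assms] by (simp add: lift_fun_def zero_fun_def)
next
  fix x y assume "x \<in> lift_fun -` S" "y \<in> lift_fun -` S"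
  then have "lift_fun x + lift_fun y \<in> S"
    using fs.subspace_add[OF assms] by simp
  then show "x + y \<in> lift_fun -` S"
    by (simp add: lift_fun_def plus_fun_def lift_add)
next
  fix c x assume "x \<in> lift_fun -` S"
  then have "fscale (lift c) (lift_fun x) \<in> S"
    using fs.subspace_scale[OF assms] by simp
  then show "fscale c x \<in> lift_fun -` S"
    by (simp add: lift_fun_def fscale_def lift_mult)
qed

text \<open>Lifting is additive and compatible with scalars from the small field, so the preimage of
  a subspace is a subspace, and minimality of the span applies.\<close>

lemma lift_fun_span_subset: "lift_fun ` fs.span B \<subseteq> fs.span (lift_fun ` B)"
proof -
  have "B \<subseteq> lift_fun -` fs.span (lift_fun ` B)"
    using fs.span_superset by blast
  from fs.span_minimal[OF this subspace_lift_fun_vimage[OF fs.subspace_span]] show ?thesis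
    by blast
qed

text \<open>A linear relation over the large field yields relations over the prime field by
  multiplying with an arbitrary scalar and taking traces.\<close>

lemma independent_lift_fun:
  assumes "fs.independent B"
  shows "fs.independent (lift_fun ` B)"
proof (rule fs.independent_if_scalars_zero)
  show "finite (lift_fun ` B)"
    by simp
  fix f x assume f: "(\<Sum>x\<in>lift_fun ` B. fscale (f x) x) = 0" and "x \<in> lift_fun ` B"
  then obtain v where v: "v \<in> B" "x = lift_fun v"
    by blast
  have rel: "(\<Sum>v\<in>B. f (lift_fun v) * lift (v t)) = 0" for t
  proof -
    have "(\<Sum>x\<in>lift_fun ` B. fscale (f x) x) t = (\<Sum>v\<in>B. f (lift_fun v) * lift (v t))"
      by (subst sum_fun_apply, subst sum.reindex[OF inj_on_subset[OF inj_lift_fun subset_UNIV]])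
        (simp add: lift_fun_def)
    then show ?thesis
      using f by simp
  qed
  have "Tr (g * f (lift_fun v)) = 0" for g
  proof -
    let ?c = "\<lambda>v. to_F3 (Tr (g * f (lift_fun v))) :: 'b"
    have "(\<Sum>v\<in>B. fscale (?c v) v) t = 0" for t
    proof -
      have Tr_sum: "Tr (\<Sum>v\<in>A. h v) = (\<Sum>v\<in>A. Tr (h v))" for A :: "('a \<Rightarrow> 'b) set" and h
        by (induction A rule: infinite_finite_induct) (simp_all add: tr_add)
      have "lift ((\<Sum>v\<in>B. fscale (?c v) v) t) = (\<Sum>v\<in>B. Tr (g * f (lift_fun v)) * lift (v t))"
        by (simp add: sum_fun_apply lift_sum lift_mult lift_to_F3[OF tr_cube])
      \<comment> \<open>Lifted scalars lie in the prime field, over which the trace is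
        linear.\<close>
      also have "\<dots> = (\<Sum>v\<in>B. Tr (lift (v t) * (g * f (lift_fun v))))"
        by (intro sum.cong refl) (simp only: tr_scale[OF lift_cube] mult.commute)
      also have "\<dots> = Tr (g * (\<Sum>v\<in>B. f (lift_fun v) * lift (v t)))"
        unfolding Tr_sum[symmetric] sum_distrib_left
        by (intro arg_cong[where f = Tr] sum.cong refl) (simp only: mult_ac)
      finally show ?thesis
        by (simp add: rel)
    qed
    then have "(\<Sum>v\<in>B. fscale (?c v) v) = 0"
      by (simp add: fun_eq_iff)
    then have "?c v = 0"
      using fs.independentD[OF assms finite order_refl _ v(1), of ?c] by blast
    then show ?thesis
      using lift_to_F3[OF tr_cube] by (metis lift_0)
  qed
  then show "f x = 0"
    unfolding v by (rule tr_nondegenerate)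
qed

text \<open>A basis chosen inside \<open>A\<close> over the small field lifts to an independent set
  of the same size, and it spans the lifted span over the large field.\<close>

lemma dim_span_lift_fun: "fs.dim (fs.span (lift_fun ` A)) = fs.dim (fs.span A)"
proof -
  obtain B where B: "B \<subseteq> A" "fs.independent B" "A \<subseteq> fs.span B"
    using fs.maximal_independent_subset[of A] by blast
  have "fs.span A = fs.span B"
    using B by (meson fs.span_minimal fs.span_mono fs.subspace_span subset_antisym)
  moreover have "fs.span (lift_fun ` A) = fs.span (lift_fun ` B)"
  proof
    have "lift_fun ` A \<subseteq> fs.span (lift_fun ` B)"
      using B(3) lift_fun_span_subset by blast
    then show "fs.span (lift_fun ` A) \<subseteq> fs.span (lift_fun ` B)"
      by (intro fs.span_minimal fs.subspace_span)
    show "fs.span (lift_fun ` B) \<subseteq> fs.span (lift_fun ` A)"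
      using B(1) by (intro fs.span_mono image_mono)
  qed
  ultimately show ?thesis
    by (simp only: fs.dim_span_eq_card_independent[OF B(2)]
        fs.dim_span_eq_card_independent[OF independent_lift_fun[OF B(2)]]
        card_image[OF inj_on_subset[OF inj_lift_fun subset_UNIV]])
qed

lemma lift_fun_incvec_supp:
  assumes "\<epsilon> \<in> {1, -1}"
  shows "lift_fun (incvec (supp a u \<epsilon>)) = (\<lambda>t. (Tr (a * nrm (t - u)) + \<epsilon>) ^ 2)"
proof
  fix t
  \<comment> \<open>The sum is put in the form of a difference of prime field elements, so its
    square is 0 or 1.\<close>
  let ?y = "Tr (a * nrm (t - u)) - (- \<epsilon>)"
  have "?y ^ 3 = ?y"
    by (rule prime_field_diff[OF tr_cube]) (use assms in auto)
  then have "?y = 0 \<or> ?y ^ 2 = 1"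
    using prime_field_cases[of ?y] by auto
  then show "lift_fun (incvec (supp a u \<epsilon>)) t = (Tr (a * nrm (t - u)) + \<epsilon>) ^ 2"
    by (auto simp: lift_fun_def incvec_def supp_def simp del: power_Suc)
qed

lemma lift_fun_incvec_blocks: "lift_fun ` incvec ` blocks m TYPE('a \<Rightarrow> 'b) = gens"
proof
  show "lift_fun ` incvec ` blocks m TYPE('a \<Rightarrow> 'b) \<subseteq> gens"
    unfolding blocks_eq gens_def using lift_fun_incvec_supp by blast
  show "gens \<subseteq> lift_fun ` incvec ` blocks m TYPE('a \<Rightarrow> 'b)"
  proof
    fix f assume "f \<in> gens"
    then obtain a u \<epsilon> where *: "a \<in> subfield" "a \<noteq> 0" "\<epsilon> \<in> {1, -1}"
      and f: "f = (\<lambda>t. (Tr (a * nrm (t - u)) + \<epsilon>) ^ 2)"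
      unfolding gens_def by blast
    have "f = lift_fun (incvec (supp a u \<epsilon>))"
      unfolding f lift_fun_incvec_supp[OF *(3)] ..
    moreover have "supp a u \<epsilon> \<in> blocks m TYPE('a \<Rightarrow> 'b)"
      unfolding blocks_eq using * by blast
    ultimately show "f \<in> lift_fun ` incvec ` blocks m TYPE('a \<Rightarrow> 'b)"
      by blast
  qed
qed

lemma dim_design_code:
  "fs.dim (design_code m :: ('a \<Rightarrow> 'b) set) = (9 * m ^ 2 + 7 * m) div 2 + 1"
  unfolding design_code_def dim_span_lift_fun[symmetric] lift_fun_incvec_blocks
  by (rule dim_span_gens)

text \<open>By linearity the distance is the weight of \<open>x - y\<close>, whose lift is a nonzero
  polynomial function of degree at most \<open>8 * 3 ^ (2 * m - 2)\<close>.\<close>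

lemma design_code_distance:
  assumes "x \<in> (design_code m :: ('a \<Rightarrow> 'b) set)" "y \<in> design_code m" "x \<noteq> y"
  shows "3 ^ (2 * m - 2) \<le> card {t. x t \<noteq> y t}"
proof -
  have "x - y \<in> design_code m"
    using assms unfolding design_code_def by (intro fs.span_diff)
  then have "lift_fun (x - y) \<in> fs.span monomials"
    unfolding design_code_def span_gens_eq[symmetric] lift_fun_incvec_blocks[symmetric]
    using lift_fun_span_subset by blast
  moreover have "lift_fun (x - y) \<noteq> 0"
    using assms(3) by (auto simp: lift_fun_def fun_eq_iff)
  ultimately have "card {t. lift_fun (x - y) t = 0} \<le> 8 * 3 ^ (2 * m - 2)"
    by (rule card_zeros_span_monomials_le[OF exponents_le])
  moreover have "{t. lift_fun (x - y) t = 0} = UNIV - {t. x t \<noteq> y t}"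
    by (auto simp: lift_fun_def)
  moreover have "card (UNIV - {t. x t \<noteq> y t}) = CARD('a) - card {t. x t \<noteq> y t}"
    by (rule card_Diff_subset) auto
  ultimately have "CARD('a) - card {t. x t \<noteq> y t} \<le> 8 * 3 ^ (2 * m - 2)"
    by simp
  then show ?thesis
    unfolding CARD_eq_9 by linarith
qed

end

theorem theorem3p16:
  fixes m :: nat
  assumes "m \<ge> 2"
    and "card (UNIV :: 'a set) = 3 ^ (2*m)"
    and "card (UNIV :: 'b set) = 3"
  shows "card (UNIV :: 'a set) = 3 ^ (2*m)
    \<and> vector_space.dim (fscale :: 'b::{field,finite} \<Rightarrow> ('a::{field,finite} \<Rightarrow> 'b) \<Rightarrow> _) (design_code m)
        = (9 * m^2 + 7 * m) div 2 + 1
    \<and> (\<forall>x \<in> (design_code m :: ('a \<Rightarrow> 'b) set). \<forall>y \<in> design_code m.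
          x \<noteq> y \<longrightarrow> card {t. x t \<noteq> y t} \<ge> 3 ^ (2*m - 2))"
proof -
  interpret ternary_pair m "TYPE('a)" "TYPE('b)"
    using assms by unfold_locales auto
  show ?thesis
    using assms dim_design_code design_code_distance by blast
qed

end
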